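(* Let $G$ be a simple graph drawn in a disk, let $X$ be the set of vertices of $G$ drawn on the boundary of the disk, and assume that $\sum_{v\in V(G)-X}\max\{6-\deg(v),0\}\le 5$. If $|X|\ge 3$, then $|V(G)|\le |X|^2/2+3|X|/2-1$.
   Context: The drawing is a planar embedding in the closed disk; $\deg(v)$ is the degree of $v$ in $G$. *)

theory Defs
  imports "HOL-Analysis.Analysis"
begin

text \<open>Finite undirected graphs without loops or parallel edges; an edge is the set of its two ends.\<close>

definition simple_graph :: "'a set \<Rightarrow> 'a set set \<Rightarrow> bool" where
  "simple_graph V E \<longleftrightarrow> finite V \<and> (\<forall>e\<in>E. e \<subseteq> V \<and> card e = 2)"

definition vertex_degree :: "'a set set \<Rightarrow> 'a \<Rightarrow> nat" where
  "vertex_degree E v = card {e \<in> E. v \<in> e}"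

text \<open>
  A drawing without crossings inside the closed set \<open>D\<close> of the plane: \<open>pos\<close> places the vertices
  at distinct points of \<open>D\<close>, and \<open>crv e\<close> is a simple arc in \<open>D\<close> joining the ends of \<open>e\<close>.
  An arc contains no vertices but its ends, and two arcs meet only in common ends. When \<open>D\<close> is
  a disk, an arc is allowed to touch or to run along its boundary.
\<close>

definition drawn_in ::
  "complex set \<Rightarrow> 'a set \<Rightarrow> 'a set set \<Rightarrow> ('a \<Rightarrow> complex) \<Rightarrow> ('a set \<Rightarrow> real \<Rightarrow> complex) \<Rightarrow> bool"
where
  "drawn_in D V E pos crv \<longleftrightarrow>
     inj_on pos V \<and> pos ` V \<subseteq> D \<and>
     (\<forall>e\<in>E. arc (crv e) \<and> path_image (crv e) \<subseteq> D \<and>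
             {pathstart (crv e), pathfinish (crv e)} = pos ` e \<and>
             path_image (crv e) \<inter> pos ` V = pos ` e) \<and>
     (\<forall>e\<in>E. \<forall>f\<in>E. e \<noteq> f \<longrightarrow>
             path_image (crv e) \<inter> path_image (crv f) = pos ` (e \<inter> f))"

end

theory Submission
  imports Defs
begin

text \<open>
  Let \<open>L\<^sub>0 = X, L\<^sub>1, L\<^sub>2, \<dots>\<close> be the distance layers of \<open>G\<close> from \<open>X\<close>. The claim is that consecutive layers
  lose at least one vertex, as long as at least two vertices remain, so that \<open>|V - X|\<close> is at most
  \<open>(k - 1) + (k - 2) + \<dots> + 1 + 1\<close> with \<open>k = |X|\<close>.

  Since \<open>X\<close> lies on the boundary of the disk, a new vertex adjacent to all of \<open>X\<close> can be drawn
  outside. Contracting this vertex together with the layers before \<open>L = L\<^sub>i\<close> to one vertex \<open>a\<close> gives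
  a planar graph in which \<open>a\<close> is joined to the vertices of \<open>L\<close>. Let \<open>U\<close> be the set of vertices
  beyond \<open>L\<close>, \<open>L' = L\<^sub>i\<^sub>+\<^sub>1\<close> the first layer of \<open>U\<close>, \<open>p\<close> the number of edges that meet \<open>U\<close> and
  \<open>q\<close> the number of edges inside \<open>U\<close>. Ignoring the edges inside \<open>L\<close>, all faces at \<open>a\<close> have length
  at least 4, and Euler's formula gives \<open>p \<le> 3|U| + |L| - 3\<close>. The same for \<open>L'\<close>, with the edges
  inside \<open>U\<close> kept, gives \<open>|L'| + q \<le> 3|U| - 3\<close>. The sum of the degrees over \<open>U\<close> is \<open>p + q\<close>, so the
  hypothesis yields \<open>6|U| - 5 \<le> p + q\<close>, and adding up, \<open>|L'| \<le> |L| - 1\<close>.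

  Euler's formula enters in the weighted form \<open>g (|E| - |V| + 2) \<le> 2 w(E)\<close>, valid if every cycle has
  weight at least \<open>g\<close>. Giving weight 0 to the edges of a spanning tree of the contracted set replaces
  the contraction.
\<close>

subsection \<open>Paths and cycles in graphs\<close>

text \<open>A path is recorded by its edge set and its vertex set instead of a list, so that
  reversal leaves both unchanged and the drawn path is a union over \<open>F\<close>. The vertex set
  is kept separately because the trivial path has no edges.\<close>

inductive gpath :: "'a set set \<Rightarrow> 'a \<Rightarrow> 'a set set \<Rightarrow> 'a set \<Rightarrow> 'a \<Rightarrow> bool" for E where
  gpath_refl: "gpath E u {} {u} u"
| gpath_step: "{u, v} \<in> E \<Longrightarrow> u \<notin> U \<Longrightarrow> gpath E v F U w \<Longrightarrow>
    gpath E u (insert {u, v} F) (insert u U) w"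

lemma gpath_start: "gpath E u F U w \<Longrightarrow> u \<in> U"
  by (cases rule: gpath.cases) auto

lemma gpath_end: "gpath E u F U w \<Longrightarrow> w \<in> U"
  by (induction rule: gpath.induct) auto

lemma gpath_finite: "gpath E u F U w \<Longrightarrow> finite F \<and> finite U"
  by (induction rule: gpath.induct) auto

lemma gpath_subset: "gpath E u F U w \<Longrightarrow> F \<subseteq> E"
  by (induction rule: gpath.induct) auto

lemma gpath_Union: "gpath E u F U w \<Longrightarrow> \<Union>F \<subseteq> U"
  by (induction rule: gpath.induct) (auto dest: gpath_start)

lemma gpath_eqD: "gpath E u F U u \<Longrightarrow> F = {} \<and> U = {u}"
  by (cases rule: gpath.cases) (auto dest: gpath_end)

lemma gpath_vertices: "gpath E u F U w \<Longrightarrow> u \<noteq> w \<Longrightarrow> U = \<Union>F"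
proof (induction rule: gpath.induct)
  case (gpath_step u v U F w)
  show ?case
  proof (cases "v = w")
    case True
    then have "F = {} \<and> U = {v}"
      using gpath_eqD gpath_step.hyps(3) by metis
    then show ?thesis by auto
  next
    case False
    then show ?thesis using gpath_step.IH gpath_start[OF gpath_step.hyps(3)] by auto
  qed
qed auto

lemma gpath_card: "gpath E u F U w \<Longrightarrow> card U = Suc (card F)"
proof (induction rule: gpath.induct)
  case (gpath_step u v U F w)
  then have "{u, v} \<notin> F" using gpath_Union by fastforce
  then show ?case using gpath_step gpath_finite by fastforce
qed auto

lemma gpath_mono: "gpath E u F U w \<Longrightarrow> F \<subseteq> E' \<Longrightarrow> gpath E' u F U w"
  by (induction rule: gpath.induct) (auto intro: gpath.intros)

lemma gpath_start_edge: "gpath E u F U w \<Longrightarrow> u \<noteq> w \<Longrightarrow> \<exists>e\<in>F. u \<in> e"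
  by (cases rule: gpath.cases) auto

lemma gpath_trans:
  assumes "gpath E u F U v" "gpath E v F' U' w" "U \<inter> U' = {v}"
  shows "gpath E u (F \<union> F') (U \<union> U') w"
  using assms
proof (induction rule: gpath.induct)
  case (gpath_refl u)
  then show ?case by (metis Un_empty_left Un_absorb1 inf.commute inf_le2)
next
  case (gpath_step u x U F v)
  then have "v \<in> U" "v \<in> U'" using gpath_start gpath_end by metis+
  then have "u \<notin> U'" "U \<inter> U' = {v}" using gpath_step.prems(2) gpath_step.hyps(2) by auto
  then have "gpath E x (F \<union> F') (U \<union> U') w" "u \<notin> U \<union> U'"
    using gpath_step.IH gpath_step.prems(1) gpath_step.hyps(2) by auto
  then show ?case
    using gpath.gpath_step[OF gpath_step.hyps(1)] by (metis Un_insert_left)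
qed

lemma gpath_edge: "{u, v} \<in> E \<Longrightarrow> u \<noteq> v \<Longrightarrow> gpath E u {{u, v}} {u, v} v"
  using gpath_step[OF _ _ gpath_refl] by force

lemma gpath_rev: "gpath E u F U w \<Longrightarrow> gpath E w F U u"
proof (induction rule: gpath.induct)
  case (gpath_step u v U F w)
  have "v \<in> U" using gpath_step.hyps(3) gpath_start by metis
  have "gpath E v {{v, u}} {v, u} u"
    using gpath_step.hyps(1,2) \<open>v \<in> U\<close> by (intro gpath_edge) (auto simp: insert_commute)
  moreover have "U \<inter> {v, u} = {v}" using gpath_step.hyps(2) \<open>v \<in> U\<close> by auto
  ultimately have "gpath E w (F \<union> {{v, u}}) (U \<union> {v, u}) u"
    using gpath_trans gpath_step.IH by metis
  moreover have "U \<union> {v, u} = insert u U" using \<open>v \<in> U\<close> by auto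
  ultimately show ?case by (simp add: insert_commute)
qed (auto intro: gpath.intros)

lemma gpath_split:
  assumes "gpath E u F U w" "x \<in> U"
  obtains A UA B UB where "gpath E u A UA x" "gpath E x B UB w" "UA \<inter> UB = {x}"
    "F = A \<union> B" "A \<inter> B = {}" "U = UA \<union> UB"
proof -
  have "\<exists>A UA B UB. gpath E u A UA x \<and> gpath E x B UB w \<and> UA \<inter> UB = {x} \<and>
    F = A \<union> B \<and> A \<inter> B = {} \<and> U = UA \<union> UB"
    using assms
  proof (induction rule: gpath.induct)
    case (gpath_refl u)
    then show ?case by (force intro: gpath.intros)
  next
    case (gpath_step u v U F w)
    show ?case
    proof (cases "x = u")
      case True
      then have "gpath E u {} {u} x" "gpath E x (insert {u, v} F) (insert u U) w"
        using gpath.gpath_refl[of E u] gpath.gpath_step[OF gpath_step.hyps] by simp_all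
      then show ?thesis using True
        by (intro exI[of _ "{}"] exI[of _ "{u}"] exI[of _ "insert {u, v} F"] exI[of _ "insert u U"]) auto
    next
      case False
      then have "x \<in> U" using gpath_step.prems by auto
      then obtain A UA B UB where *: "gpath E v A UA x" "gpath E x B UB w" "UA \<inter> UB = {x}"
        "F = A \<union> B" "A \<inter> B = {}" "U = UA \<union> UB" using gpath_step.IH by blast
      have "{u, v} \<notin> B" using *(2,6) gpath_step.hyps(2) gpath_Union by fastforce
      then have "insert {u, v} A \<inter> B = {}" using * by auto
      moreover have "gpath E u (insert {u, v} A) (insert u UA) x"
        using gpath.gpath_step[OF gpath_step.hyps(1) _ *(1)] gpath_step.hyps(2) *(6) by simp
      moreover have "insert u UA \<inter> UB = {x}" using * gpath_step.hyps(2) by auto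
      moreover have "insert {u, v} F = insert {u, v} A \<union> B" "insert u U = insert u UA \<union> UB"
        using *(4,6) by simp_all
      ultimately show ?thesis using *(2) by metis
    qed
  qed
  then show ?thesis using that by (elim exE conjE)
qed

text \<open>If \<open>w\<close> already lies on the path, the path is cut off at \<open>w\<close>;
  otherwise the edge is appended. Hence only inclusions are claimed for the new sets.\<close>

lemma gpath_extend:
  assumes "gpath E u F U v" "{v, w} \<in> E"
  obtains F' U' where "gpath E u F' U' w" "U' \<subseteq> insert w U" "F' \<subseteq> insert {v, w} F"
proof (cases "w \<in> U")
  case True
  then obtain A UA B UB where "gpath E u A UA w" "F = A \<union> B" "U = UA \<union> UB"
    using gpath_split[OF assms(1)] by metis
  then show ?thesis using that[of A UA] by blast
next
  case False
  moreover have "v \<in> U" using assms(1) gpath_end by metis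
  ultimately have "gpath E v {{v, w}} {v, w} w" "U \<inter> {v, w} = {v}"
    using assms(2) by (auto intro!: gpath_edge)
  then have "gpath E u (F \<union> {{v, w}}) (U \<union> {v, w}) w"
    using assms(1) by (intro gpath_trans)
  then show ?thesis using that[of "F \<union> {{v,w}}" "U \<union> {v,w}"] \<open>v \<in> U\<close> by auto
qed

text \<open>The two ends are explicit so that a cycle can be split wherever an ear is attached.
  Disjointness of the edge sets excludes the degenerate case of one edge used twice, which the
  condition on the vertex sets would allow.\<close>

definition cycle_at :: "'a set set \<Rightarrow> 'a \<Rightarrow> 'a \<Rightarrow> 'a set set \<Rightarrow> 'a set \<Rightarrow> bool" where
  "cycle_at E u v C W \<longleftrightarrow> u \<noteq> v \<and> (\<exists>F1 U1 F2 U2. gpath E u F1 U1 v \<and> gpath E u F2 U2 v \<and>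
     U1 \<inter> U2 = {u, v} \<and> F1 \<inter> F2 = {} \<and> C = F1 \<union> F2 \<and> W = U1 \<union> U2)"

definition cycle :: "'a set set \<Rightarrow> 'a set set \<Rightarrow> 'a set \<Rightarrow> bool" where
  "cycle E C W \<longleftrightarrow> (\<exists>u v. cycle_at E u v C W)"

lemma cycle_atE:
  assumes "cycle_at E u v C W"
  obtains F1 U1 F2 U2 where "u \<noteq> v" "gpath E u F1 U1 v" "gpath E u F2 U2 v"
     "U1 \<inter> U2 = {u, v}" "F1 \<inter> F2 = {}" "C = F1 \<union> F2" "W = U1 \<union> U2"
  using assms unfolding cycle_at_def by blast

lemma cycle_atI:
  assumes "u \<noteq> v" "gpath E u F1 U1 v" "gpath E u F2 U2 v" "U1 \<inter> U2 = {u, v}" "F1 \<inter> F2 = {}"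
  shows "cycle_at E u v (F1 \<union> F2) (U1 \<union> U2)"
  unfolding cycle_at_def using assms by fast

lemma cycle_at_sym:
  assumes "cycle_at E u v C W"
  shows "cycle_at E v u C W"
  using assms
proof (cases rule: cycle_atE)
  case (1 F1 U1 F2 U2)
  have "cycle_at E v u (F1 \<union> F2) (U1 \<union> U2)"
    using 1(1,4,5) by (intro cycle_atI gpath_rev[OF 1(2)] gpath_rev[OF 1(3)]) auto
  then show ?thesis using 1 by simp
qed

text \<open>The first path is cut at \<open>x\<close>; its tail from \<open>x\<close> to
  \<open>v\<close> is reversed and appended to the second path, which then also ends in
  \<open>x\<close>.\<close>

lemma cycle_at_move_aux:
  assumes "gpath E u F1 U1 v" "gpath E u F2 U2 v" "U1 \<inter> U2 = {u, v}" "F1 \<inter> F2 = {}"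
    "x \<in> U1" "x \<noteq> u"
  shows "cycle_at E u x (F1 \<union> F2) (U1 \<union> U2)"
proof -
  obtain A UA B UB where *: "gpath E u A UA x" "gpath E x B UB v" "UA \<inter> UB = {x}"
    "F1 = A \<union> B" "A \<inter> B = {}" "U1 = UA \<union> UB" using gpath_split assms by metis
  have u: "u \<in> UA" "v \<in> UB" "u \<in> U2" "v \<in> U2" using * assms gpath_start gpath_end by metis+
  have sub: "UA \<subseteq> U1" "UB \<subseteq> U1" "A \<subseteq> F1" "A \<inter> B = {}" using * by auto
  have "u \<notin> UB" using u(1) *(3) assms(6) by auto
  have "U2 \<inter> UB = {v}" using u(2,4) sub(2) assms(3) \<open>u \<notin> UB\<close> by auto
  then have "gpath E u (F2 \<union> B) (U2 \<union> UB) x"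
    using gpath_trans[OF assms(2) gpath_rev[OF *(2)]] by simp
  moreover have "UA \<inter> (U2 \<union> UB) = {u, x}"
  proof -
    have "UA \<inter> U2 \<subseteq> {u, v}" using sub(1) assms(3) by auto
    then have "UA \<inter> U2 \<subseteq> {u, x}" using u(2) *(3) by auto
    then show ?thesis using u(1,3) *(3) by auto
  qed
  moreover have "A \<inter> (F2 \<union> B) = {}" using sub(3,4) assms(4) by auto
  ultimately have "cycle_at E u x (A \<union> (F2 \<union> B)) (UA \<union> (U2 \<union> UB))"
    using *(1) \<open>x \<noteq> u\<close> by (intro cycle_atI) auto
  moreover have "A \<union> (F2 \<union> B) = F1 \<union> F2" "UA \<union> (U2 \<union> UB) = U1 \<union> U2" using *(4,6) by auto
  ultimately show ?thesis by simp
qed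

lemma cycle_at_move:
  assumes "cycle_at E u v C W" "x \<in> W" "x \<noteq> u"
  shows "cycle_at E u x C W"
  using assms(1)
proof (cases rule: cycle_atE)
  case (1 F1 U1 F2 U2)
  then show ?thesis
    using cycle_at_move_aux[of E u F1 U1 v F2 U2 x] cycle_at_move_aux[of E u F2 U2 v F1 U1 x] assms
    by (auto simp: Un_commute Int_commute)
qed

lemma cycle_at_ends:
  assumes "cycle_at E u v C W"
  shows "u \<in> W" "v \<in> W" "u \<noteq> v"
  using assms by (auto elim!: cycle_atE dest: gpath_start gpath_end)

text \<open>Moving one end, exchanging the ends and moving the other one reaches every pair. This
  provides the two arcs of a cycle between the ends of an ear.\<close>

lemma cycle_at_any:
  assumes "cycle E C W" "x \<in> W" "y \<in> W" "x \<noteq> y"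
  shows "cycle_at E x y C W"
proof -
  obtain u v where "cycle_at E u v C W" using assms cycle_def by metis
  then show ?thesis using assms cycle_at_move cycle_at_sym by metis
qed

lemma cycleE:
  assumes "cycle E C W"
  obtains u v F1 U1 F2 U2 where "u \<noteq> v" "gpath E u F1 U1 v" "gpath E u F2 U2 v"
     "U1 \<inter> U2 = {u, v}" "F1 \<inter> F2 = {}" "C = F1 \<union> F2" "W = U1 \<union> U2"
proof -
  obtain u v where "cycle_at E u v C W" using assms cycle_def by metis
  then show ?thesis using that by (cases rule: cycle_atE)
qed

lemma cycle_card:
  assumes "cycle E C W"
  shows "card C = card W"
  using assms
proof (cases rule: cycleE)
  case (1 u v F1 U1 F2 U2)
  have fin: "finite F1" "finite U1" "finite F2" "finite U2"
    using gpath_finite[OF 1(2)] gpath_finite[OF 1(3)] by auto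
  have "card C = card F1 + card F2" using 1(5,6) fin by (simp add: card_Un_disjoint)
  moreover have "card W + 2 = card U1 + card U2"
    using card_Un_Int[of U1 U2] fin 1(1,4,7) by simp
  ultimately show ?thesis using gpath_card[OF 1(2)] gpath_card[OF 1(3)] by simp
qed

lemma cycle_subset:
  assumes "cycle E C W"
  shows "C \<subseteq> E"
  using assms by (cases rule: cycleE) (simp add: gpath_subset)

lemma cycle_vertices:
  assumes "cycle E C W"
  shows "W = \<Union>C"
  using assms
proof (cases rule: cycleE)
  case (1 u v F1 U1 F2 U2)
  then show ?thesis using gpath_vertices[OF 1(2)] gpath_vertices[OF 1(3)] by simp
qed

lemma cycle_finite:
  assumes "cycle E C W"
  shows "finite C" "finite W"
  using assms by (auto elim!: cycleE dest: gpath_finite)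

lemma cycle_mono:
  assumes "cycle E C W" "C \<subseteq> E'"
  shows "cycle E' C W"
  using assms(1)
proof (cases rule: cycleE)
  case (1 u v F1 U1 F2 U2)
  have "cycle_at E' u v (F1 \<union> F2) (U1 \<union> U2)"
    using assms(2) 1(1,4,5,6) by (intro cycle_atI gpath_mono[OF 1(2)] gpath_mono[OF 1(3)]) auto
  then show ?thesis using 1(6,7) cycle_def by metis
qed

lemma cycle_nonempty:
  assumes "cycle E C W"
  shows "C \<noteq> {}"
  using assms
proof (cases rule: cycleE)
  case (1 u v F1 U1 F2 U2)
  then show ?thesis using gpath_start_edge[OF 1(2)] by auto
qed

section \<open>Leafless edge sets and forests\<close>

text \<open>A set of edges is a forest iff it has no \<open>leafless\<close> subset.\<close>

definition leafless :: "'a set set \<Rightarrow> bool" where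
  "leafless C \<longleftrightarrow> C \<noteq> {} \<and> (\<forall>e\<in>C. \<forall>v\<in>e. \<exists>f\<in>C. f \<noteq> e \<and> v \<in> f)"

lemma leaflessE:
  assumes "leafless C" "e \<in> C" "v \<in> e"
  obtains f where "f \<in> C" "f \<noteq> e" "v \<in> f"
  using assms unfolding leafless_def by metis

text \<open>Splitting the cycle at \<open>v\<close> gives two edge-disjoint paths that start in
  \<open>v\<close>, hence two edges of \<open>C\<close> at \<open>v\<close>, one of which differs
  from \<open>e\<close>.\<close>

lemma cycle_leafless:
  assumes "cycle E C W"
  shows "leafless C"
  unfolding leafless_def
proof (intro conjI ballI)
  show "C \<noteq> {}" using cycle_nonempty[OF assms] .
next
  fix e v assume ev: "e \<in> C" "v \<in> e"
  then have "v \<in> W" using assms cycle_vertices by auto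
  moreover obtain a b where ab: "cycle_at E a b C W" using assms cycle_def by metis
  ultimately obtain y where "y \<in> W" "v \<noteq> y" using cycle_at_ends by metis
  then have "cycle_at E v y C W" using \<open>v \<in> W\<close> assms cycle_at_any by metis
  then show "\<exists>f\<in>C. f \<noteq> e \<and> v \<in> f"
  proof (cases rule: cycle_atE)
    case (1 F1 U1 F2 U2)
    then obtain f g where fg: "f \<in> F1" "v \<in> f" "g \<in> F2" "v \<in> g" using gpath_start_edge by metis
    then have "f \<noteq> g" "f \<in> C" "g \<in> C" using 1(5,6) by auto
    then show ?thesis using fg(2,4) by metis
  qed
qed

text \<open>Take a longest path. Its start \<open>u\<close> has a second edge in \<open>C\<close>,
  and by maximality the other end \<open>x\<close> of that edge lies on the path. The edge closes a
  cycle with the segment from \<open>u\<close> to \<open>x\<close>.\<close>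

lemma leafless_cycle:
  assumes "leafless C" "finite (\<Union>C)" "\<forall>e\<in>C. card e = 2"
  shows "\<exists>D W. cycle C D W"
proof -
  let ?P = "\<lambda>n. \<exists>u F U w. gpath C u F U w \<and> u \<noteq> w \<and> n = card U"
  obtain e where "e \<in> C" using assms(1) unfolding leafless_def by auto
  then obtain a b where "e = {a, b}" "a \<noteq> b" using assms by (metis card_2_iff)
  then have "gpath C a {{a, b}} {a, b} b" "2 = card {a, b}"
    using gpath_edge[of a b C] \<open>e \<in> C\<close> by auto
  then have ex: "?P 2" using \<open>a \<noteq> b\<close> by blast
  have sub: "U \<subseteq> \<Union>C" if "gpath C u F U w" "u \<noteq> w" for u F U w
    using that gpath_vertices gpath_subset by (metis Union_mono)
  then have bd: "\<forall>n. ?P n \<longrightarrow> n \<le> card (\<Union>C)" using assms card_mono by metis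
  define n where "n = (GREATEST n. ?P n)"
  have n: "?P n" unfolding n_def using GreatestI_nat[of ?P, OF ex] bd by blast
  have max: "m \<le> n" if "?P m" for m
    unfolding n_def using Greatest_le_nat[of ?P, OF that] bd by blast
  obtain u F U w where p: "gpath C u F U w" "u \<noteq> w" "n = card U" using n by blast
  from p(1) show ?thesis
  proof (cases rule: gpath.cases)
    case gpath_refl
    then show ?thesis using p by auto
  next
    case (gpath_step v U' F')
    have "{u, v} \<in> C" "u \<in> {u, v}" using gpath_step by auto
    then obtain f where f: "f \<in> C" "f \<noteq> {u, v}" "u \<in> f" using leaflessE[OF assms(1)] by metis
    obtain y z where "f = {y, z}" "y \<noteq> z" using assms(3) f(1) by (meson card_2_iff)
    then obtain x where x: "f = {u, x}" "u \<noteq> x" using f(3) by (cases "u = y") (auto simp: insert_commute)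
    have "x \<in> U"
    proof (rule ccontr)
      assume "x \<notin> U"
      then have *: "gpath C x (insert {x, u} F) (insert x U) w"
        using f(1) x(1) p(1) by (intro gpath.gpath_step) (simp_all add: insert_commute)
      have "x \<noteq> w" using \<open>x \<notin> U\<close> p gpath_end by metis
      then have "card (insert x U) \<le> n" using * max by blast
      then have "Suc n \<le> n" using p(3) \<open>x \<notin> U\<close> gpath_finite[OF p(1)] by simp
      then show False by simp
    qed
    moreover have "x \<noteq> v" using f x by auto
    ultimately have "x \<in> U'" using gpath_step(2) x(2) by auto
    then obtain A UA B UB where *: "gpath C v A UA x" "gpath C x B UB w" "U' = UA \<union> UB"
      using gpath_split[OF gpath_step(5)] by metis
    have "gpath C u (insert {u, v} A) (insert u UA) x"
      using gpath_step(3,4) *(1,3) by (intro gpath.gpath_step) auto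
    moreover have "gpath C u {{u, x}} {u, x} x" using f x gpath_edge by metis
    moreover have "{u, x} \<notin> insert {u, v} A"
      using f(2) x(1) *(3) gpath_step(4) gpath_Union[OF *(1)] by auto
    moreover have "insert u UA \<inter> {u, x} = {u, x}" using gpath_end[OF *(1)] by auto
    ultimately have "cycle_at C u x (insert {u, v} A \<union> {{u, x}}) (insert u UA \<union> {u, x})"
      using x(2) by (intro cycle_atI) auto
    then show ?thesis unfolding cycle_def by blast
  qed
qed

text \<open>Induction on the number of vertices. As \<open>E\<close> itself is not leafless, some
  edge \<open>e\<close> is the only edge at one of its ends \<open>v\<close>; both are
  deleted.\<close>

lemma forest_card:
  assumes "simple_graph V E" "V \<noteq> {}" "\<forall>C\<subseteq>E. \<not> leafless C"
  shows "card E + 1 \<le> card V"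
  using assms
proof (induction "card V" arbitrary: V E)
  case 0
  then show ?case by (simp add: simple_graph_def)
next
  case (Suc n)
  have fin: "finite V" "\<forall>e\<in>E. e \<subseteq> V \<and> card e = 2" using Suc.prems simple_graph_def by metis+
  then have finE: "finite E" by (meson PowI finite_Pow_iff finite_subset subsetI)
  show ?case
  proof (cases "E = {}")
    case True
    then show ?thesis using Suc by simp
  next
    case False
    moreover have "\<not> leafless E" using Suc.prems(3) by simp
    ultimately obtain e v where e: "e \<in> E" "v \<in> e" "\<forall>f\<in>E. v \<in> f \<longrightarrow> f = e"
      unfolding leafless_def by metis
    obtain x where x: "x \<in> e" "x \<noteq> v" using e fin by (metis card_2_iff')
    have "e \<subseteq> V" using fin(2) e(1) by metis
    then have "v \<in> V" "x \<in> V" using e(2) x(1) by blast+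
    have "card (E - {e}) + 1 \<le> card (V - {v})"
    proof (rule Suc.hyps(1))
      show "n = card (V - {v})" using Suc.hyps(2) fin(1) \<open>v \<in> V\<close> by simp
      show "simple_graph (V - {v}) (E - {e})" using fin e(3) by (auto simp: simple_graph_def)
      show "V - {v} \<noteq> {}" using x \<open>x \<in> V\<close> by auto
      show "\<forall>C\<subseteq>E - {e}. \<not> leafless C" using Suc.prems(3) by blast
    qed
    moreover have "card E = Suc (card (E - {e}))" "card V = Suc (card (V - {v}))"
      using card.remove fin(1) finE e(1) \<open>v \<in> V\<close> by metis+
    ultimately show ?thesis by simp
  qed
qed

subsection \<open>Plane graphs and the two sides of a cycle\<close>

lemma connected_subset_open_Un:
  assumes "connected S" "S \<subseteq> A \<union> B" "open A" "open B" "A \<inter> B = {}"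
  shows "S \<subseteq> A \<or> S \<subseteq> B"
proof -
  have "A \<inter> S = {} \<or> B \<inter> S = {}" using assms by (intro connectedD) auto
  then show ?thesis using assms(2) by blast
qed

text \<open>The ambient set is the whole plane because inversions and the apex take the drawing out
  of the disk.\<close>

locale plane_graph =
  fixes V :: "'a set" and E :: "'a set set"
    and pos :: "'a \<Rightarrow> complex" and crv :: "'a set \<Rightarrow> real \<Rightarrow> complex"
  assumes simple: "simple_graph V E"
    and drawn: "drawn_in UNIV V E pos crv"
begin

lemma finite_V: "finite V" and edge_sub: "e \<in> E \<Longrightarrow> e \<subseteq> V" and edge_card: "e \<in> E \<Longrightarrow> card e = 2"
  using simple by (auto simp: simple_graph_def)

lemma finite_E: "finite E"
  using finite_V edge_sub by (meson PowI finite_Pow_iff finite_subset subsetI)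

lemma inj_pos: "inj_on pos V"
  using drawn by (auto simp: drawn_in_def)

lemma arc_crv: "e \<in> E \<Longrightarrow> arc (crv e)"
  and ends_crv: "e \<in> E \<Longrightarrow> {pathstart (crv e), pathfinish (crv e)} = pos ` e"
  and crv_pos: "e \<in> E \<Longrightarrow> path_image (crv e) \<inter> pos ` V = pos ` e"
  and crv_crv: "e \<in> E \<Longrightarrow> f \<in> E \<Longrightarrow> e \<noteq> f \<Longrightarrow> path_image (crv e) \<inter> path_image (crv f) = pos ` (e \<inter> f)"
  using drawn by (auto simp: drawn_in_def)

definition "img F = (\<Union>e\<in>F. path_image (crv e))"
text \<open>The ends are removed because they may lie on a cycle to which the edge does not belong;
  the connected open arc then decides on which side the edge lies.\<close>

definition "eint e = path_image (crv e) - pos ` e"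

lemma subgraph:
  assumes "V' \<subseteq> V" "E' \<subseteq> E" "\<And>e. e \<in> E' \<Longrightarrow> e \<subseteq> V'"
  shows "plane_graph V' E' pos crv"
proof
  show "simple_graph V' E'"
    using assms finite_V edge_card finite_subset unfolding simple_graph_def by (metis subset_iff)
  have 1: "path_image (crv e) \<inter> pos ` V' = pos ` e" if "e \<in> E'" for e
  proof -
    have "e \<in> E" "pos ` e \<subseteq> pos ` V'" "pos ` V' \<subseteq> pos ` V"
      using that assms(1,2) assms(3)[OF that] by (auto intro: image_mono)
    then have "path_image (crv e) \<inter> pos ` V' = pos ` e \<inter> pos ` V'"
      using crv_pos[of e] by (metis Int_absorb1 Int_assoc)
    then show ?thesis using \<open>pos ` e \<subseteq> pos ` V'\<close> by (simp add: Int_absorb2)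
  qed
  have 2: "e \<in> E" if "e \<in> E'" for e using that assms(2) by blast
  have "inj_on pos V'" using inj_pos assms(1) inj_on_subset by metis
  then show "drawn_in UNIV V' E' pos crv"
    unfolding drawn_in_def using 1 arc_crv[OF 2] ends_crv[OF 2] crv_crv[OF 2 2] by simp
qed

lemma pos_img:
  assumes "x \<in> V" "F \<subseteq> E" "pos x \<in> img F"
  shows "x \<in> \<Union>F"
proof -
  obtain e where e: "e \<in> F" "pos x \<in> path_image (crv e)" using assms by (auto simp: img_def)
  then have "pos x \<in> pos ` e" using crv_pos[of e] assms by blast
  then obtain y where "y \<in> e" "pos y = pos x" by auto
  moreover have "y \<in> V" using \<open>y \<in> e\<close> e assms edge_sub by blast
  ultimately have "x = y" using inj_pos assms(1) by (metis inj_onD)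
  then show ?thesis using \<open>y \<in> e\<close> e by auto
qed

lemma pos_in_crv: "e \<in> E \<Longrightarrow> x \<in> e \<Longrightarrow> pos x \<in> path_image (crv e)"
  using crv_pos by blast

lemma pos_in_img: "x \<in> \<Union>F \<Longrightarrow> F \<subseteq> E \<Longrightarrow> pos x \<in> img F"
  unfolding img_def using pos_in_crv by blast

lemma img_Int:
  assumes "A \<subseteq> E" "B \<subseteq> E" "A \<inter> B = {}"
  shows "img A \<inter> img B \<subseteq> pos ` (\<Union>A \<inter> \<Union>B)"
proof
  fix z assume "z \<in> img A \<inter> img B"
  then obtain e f where ef: "e \<in> A" "f \<in> B" "z \<in> path_image (crv e)" "z \<in> path_image (crv f)"
    by (auto simp: img_def)
  then have "e \<noteq> f" "e \<in> E" "f \<in> E" using assms by auto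
  then have "z \<in> pos ` (e \<inter> f)" using crv_crv ef by blast
  then show "z \<in> pos ` (\<Union>A \<inter> \<Union>B)" using ef by blast
qed

lemma eint_connected: "e \<in> E \<Longrightarrow> connected (eint e)"
  unfolding eint_def using connected_simple_path_endless arc_imp_simple_path arc_crv ends_crv by metis

lemma eint_nonempty: "e \<in> E \<Longrightarrow> eint e \<noteq> {}"
  unfolding eint_def using simple_path_endless nonempty_simple_path_endless arc_imp_simple_path arc_crv ends_crv by metis

lemma eint_in_img: "e \<in> F \<Longrightarrow> eint e \<subseteq> img F"
  by (auto simp: eint_def img_def)

lemma eint_Int: "e \<in> E \<Longrightarrow> eint e \<subseteq> A \<Longrightarrow> eint e \<subseteq> B \<Longrightarrow> A \<inter> B \<noteq> {}"
  using eint_nonempty by blast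

lemma eint_img:
  assumes "e \<in> E" "F \<subseteq> E" "e \<notin> F"
  shows "eint e \<inter> img F = {}"
proof (rule ccontr)
  assume "eint e \<inter> img F \<noteq> {}"
  then obtain z f where z: "z \<in> path_image (crv e)" "z \<notin> pos ` e" "f \<in> F" "z \<in> path_image (crv f)"
    by (auto simp: eint_def img_def)
  then have "e \<noteq> f" "f \<in> E" using assms by auto
  then show False using crv_crv[OF assms(1)] z by blast
qed

lemma eint_pos: "e \<in> E \<Longrightarrow> x \<in> V \<Longrightarrow> pos x \<notin> eint e"
  using crv_pos by (auto simp: eint_def)

lemma closure_eint:
  assumes "e \<in> E"
  shows "path_image (crv e) \<subseteq> closure (eint e)"
proof -
  have "eint e = crv e ` {0<..<1}"
    unfolding eint_def using simple_path_endless[OF arc_imp_simple_path[OF arc_crv]] ends_crv assms by metis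
  moreover have "crv e ` closure {0<..<1} \<subseteq> closure (crv e ` {0<..<1})"
    using arc_crv[OF assms] by (intro continuous_image_closure_subset[of "{0..1}"]) (auto simp: arc_def path_def)
  ultimately show ?thesis by (simp add: path_image_def)
qed

lemma gpath_arc:
  assumes "gpath E u F U w" "u \<noteq> w"
  obtains \<gamma> where "arc \<gamma>" "pathstart \<gamma> = pos u" "pathfinish \<gamma> = pos w" "path_image \<gamma> = img F"
proof -
  have "\<exists>\<gamma>. arc \<gamma> \<and> pathstart \<gamma> = pos u \<and> pathfinish \<gamma> = pos w \<and> path_image \<gamma> = img F"
    using assms
  proof (induction rule: gpath.induct)
    case (gpath_step u v U F w)
    have e: "{u, v} \<in> E" by fact
    then have "{pathstart (crv {u, v}), pathfinish (crv {u, v})} = {pos u, pos v}"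
      using ends_crv by force
    then have "pathstart (crv {u, v}) = pos u \<and> pathfinish (crv {u, v}) = pos v \<or>
      pathstart (crv {u, v}) = pos v \<and> pathfinish (crv {u, v}) = pos u"
      by (auto simp: doubleton_eq_iff)
    \<comment> \<open>The curve of an edge has no prescribed direction, so it is reversed if it
      starts at \<open>v\<close>.\<close>
    then obtain \<gamma> where g: "arc \<gamma>" "pathstart \<gamma> = pos u" "pathfinish \<gamma> = pos v"
      "path_image \<gamma> = path_image (crv {u, v})"
      using arc_crv[OF e] by (metis arc_reversepath path_image_reversepath pathfinish_reversepath pathstart_reversepath)
    show ?case
    proof (cases "v = w")
      case True
      then have "F = {}" using gpath_eqD gpath_step.hyps(3) by metis
      then show ?thesis using g True by (auto simp: img_def)
    next
      case False
      then obtain d where d: "arc d" "pathstart d = pos v" "pathfinish d = pos w" "path_image d = img F"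
        using gpath_step.IH by blast
      have FE: "F \<subseteq> E" "\<Union>F \<subseteq> U" using gpath_step.hyps(3) gpath_subset gpath_Union by metis+
      then have "{u, v} \<notin> F" using gpath_step.hyps(2) by auto
      then have "img {{u, v}} \<inter> img F \<subseteq> pos ` ({u, v} \<inter> \<Union>F)"
        using img_Int[of "{{u, v}}" F] e FE(1) by auto
      also have "\<dots> \<subseteq> {pos v}" using FE(2) gpath_step.hyps(2) by auto
      finally have "path_image \<gamma> \<inter> path_image d \<subseteq> {pathstart d}"
        using g d by (simp add: img_def)
      then have "arc (\<gamma> +++ d)" using g d by (intro arc_join) auto
      moreover have "path_image (\<gamma> +++ d) = img (insert {u, v} F)"
        using g d by (subst path_image_join) (auto simp: img_def)
      ultimately show ?thesis using g d by (metis pathfinish_join pathstart_join)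
    qed
  qed auto
  then show ?thesis using that by blast
qed

lemma cycle_curve:
  assumes "cycle E C W"
  obtains c where "simple_path c" "pathfinish c = pathstart c" "path_image c = img C"
  using assms
proof (cases rule: cycleE)
  case (1 u v F1 U1 F2 U2)
  obtain a where a: "arc a" "pathstart a = pos u" "pathfinish a = pos v" "path_image a = img F1"
    using gpath_arc[OF 1(2,1)] .
  obtain b where b: "arc b" "pathstart b = pos u" "pathfinish b = pos v" "path_image b = img F2"
    using gpath_arc[OF 1(3,1)] .
  have "img F1 \<inter> img F2 \<subseteq> pos ` (\<Union>F1 \<inter> \<Union>F2)"
    using 1(5) gpath_subset[OF 1(2)] gpath_subset[OF 1(3)] by (intro img_Int)
  also have "\<dots> \<subseteq> pos ` {u, v}" 
    using Int_mono[OF gpath_Union[OF 1(2)] gpath_Union[OF 1(3)]] 1(4) by (intro image_mono) simp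
  finally have "simple_path (a +++ reversepath b)"
    using a b by (intro simple_path_join_loop) (auto simp: arc_reversepath)
  moreover have "path_image (a +++ reversepath b) = img C"
    using a b 1(6) by (subst path_image_join) (auto simp: img_def)
  ultimately show ?thesis using that[of "a +++ reversepath b"] a b by simp
qed

section \<open>The edges and vertices inside and outside a cycle\<close>

definition "iedges C = {e \<in> E. eint e \<subseteq> inside (img C)}"
definition "oedges C = {e \<in> E. eint e \<subseteq> outside (img C)}"
definition "iverts C = {v \<in> V. pos v \<in> inside (img C)}"
definition "overts C = {v \<in> V. pos v \<in> outside (img C)}"

text \<open>By the Jordan curve theorem the complement of the drawn cycle consists of two disjoint
  open sets. The open arc of an edge not in \<open>C\<close> is connected and misses the curve, so
  it stays in one of them.\<close>

lemma edges_partition: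
  assumes "cycle E C W"
  shows "E = C \<union> iedges C \<union> oedges C" "C \<inter> iedges C = {}" "C \<inter> oedges C = {}" "iedges C \<inter> oedges C = {}"
proof -
  obtain c where c: "simple_path c" "pathfinish c = pathstart c" "path_image c = img C"
    using cycle_curve[OF assms] .
  note J = Jordan_inside_outside[OF c(1,2), unfolded c(3)]
  have CE: "C \<subseteq> E" using assms cycle_subset by metis
  have C: "eint e \<subseteq> img C" "e \<in> E" if "e \<in> C" for e using that CE eint_in_img by auto
  show "C \<inter> iedges C = {}"
  proof (rule ccontr)
    assume "C \<inter> iedges C \<noteq> {}"
    then obtain e where "e \<in> C" "eint e \<subseteq> inside (img C)" unfolding iedges_def by auto
    then show False using eint_Int C inside_no_overlap by metis
  qed
  show "C \<inter> oedges C = {}"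
  proof (rule ccontr)
    assume "C \<inter> oedges C \<noteq> {}"
    then obtain e where "e \<in> C" "eint e \<subseteq> outside (img C)" unfolding oedges_def by auto
    then show False using eint_Int C outside_no_overlap by metis
  qed
  show "iedges C \<inter> oedges C = {}"
  proof (rule ccontr)
    assume "iedges C \<inter> oedges C \<noteq> {}"
    then obtain e where "e \<in> E" "eint e \<subseteq> inside (img C)" "eint e \<subseteq> outside (img C)"
      unfolding iedges_def oedges_def by auto
    then show False using eint_Int inside_Int_outside by metis
  qed
  have "e \<in> iedges C \<union> oedges C" if "e \<in> E" "e \<notin> C" for e
  proof -
    have "eint e \<subseteq> inside (img C) \<union> outside (img C)"
      using eint_img[OF that(1) CE that(2)] inside_Un_outside[of "img C"] by auto
    then have "eint e \<subseteq> inside (img C) \<or> eint e \<subseteq> outside (img C)"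
      using J by (intro connected_subset_open_Un eint_connected that) auto
    then show ?thesis using that by (auto simp: iedges_def oedges_def)
  qed
  then show "E = C \<union> iedges C \<union> oedges C" using CE by (auto simp: iedges_def oedges_def)
qed

lemma verts_partition:
  assumes "cycle E C W"
  shows "V = W \<union> iverts C \<union> overts C" "W \<inter> iverts C = {}" "W \<inter> overts C = {}" "iverts C \<inter> overts C = {}"
proof -
  have CE: "C \<subseteq> E" "W = \<Union>C" using assms cycle_subset cycle_vertices by metis+
  then have W: "pos x \<in> img C \<longleftrightarrow> x \<in> W" if "x \<in> V" for x using pos_img pos_in_img that by metis
  have "W \<subseteq> V" using CE edge_sub by blast
  have "pos x \<in> inside (img C) \<or> pos x \<in> outside (img C)" if "x \<in> V" "x \<notin> W" for x
    using inside_Un_outside[of "img C"] W that by blast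
  then show "V = W \<union> iverts C \<union> overts C" using \<open>W \<subseteq> V\<close> by (auto simp: iverts_def overts_def)
  show "W \<inter> iverts C = {}" using W inside_no_overlap[of "img C"] unfolding iverts_def by blast
  show "W \<inter> overts C = {}" using W outside_no_overlap[of "img C"] unfolding overts_def by blast
  show "iverts C \<inter> overts C = {}" using inside_Int_outside[of "img C"] unfolding iverts_def overts_def by blast
qed

end

subsection \<open>Theta graphs and inversion\<close>

text \<open>Let \<open>T\<close> be the component of the image of \<open>z\<close> off the image of
  \<open>S\<close>. Removing 0, the image of infinity, keeps it connected, and the inverse map sends
  \<open>T - {0}\<close> into the outside of \<open>S\<close>. This avoids a ball of radius
  \<open>d\<close> around \<open>p\<close>, so \<open>T\<close> is bounded by
  \<open>1 / d\<close>.\<close>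

lemma inversion_outside_inside:
  fixes p z :: complex
  assumes "compact S" "p \<in> inside S" "z \<in> outside S"
  shows "1 / (z - p) \<in> inside ((\<lambda>x. 1 / (x - p)) ` S)"
proof -
  define f where "f = (\<lambda>x. 1 / (x - p))"
  define T where "T = connected_component_set (- f ` S) (f z)"
  have pS: "p \<notin> S" and zS: "z \<notin> S" and zp: "z \<noteq> p"
    using assms(2,3) inside_no_overlap[of S] outside_no_overlap[of S] inside_Int_outside[of S] by blast+
  have gf: "p + 1 / f x = x" if "x \<noteq> p" for x using that by (simp add: f_def)
  have fg: "f (p + 1 / y) = y" if "y \<noteq> 0" for y using that by (simp add: f_def)
  have "continuous_on S f" unfolding f_def using pS by (intro continuous_intros) auto
  then have cfS: "compact (f ` S)" using assms(1) compact_continuous_image by blast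
  have "open T" unfolding T_def using cfS by (intro open_connected_component) (simp add: compact_imp_closed open_Compl)
  moreover have "connected T" by (simp add: T_def)
  ultimately have conT: "connected (T - {0})" by (intro connected_open_delete) auto
  have fzS: "f z \<notin> f ` S"
  proof
    assume "f z \<in> f ` S"
    then obtain s where "s \<in> S" "f z = f s" by auto
    then have "z = s" using gf zp pS by metis
    then show False using zS \<open>s \<in> S\<close> by simp
  qed
  have "f z \<noteq> 0" using zp by (simp add: f_def)
  then have fzT: "f z \<in> T - {0}" using fzS by (simp add: T_def connected_component_refl)
  have "connected ((\<lambda>y. p + 1 / y) ` (T - {0}))" (is "connected ?G")
    using conT by (intro connected_continuous_image continuous_intros) auto
  moreover have "?G \<subseteq> - S"
  proof clarify
    fix y assume "y \<in> T" "y \<noteq> 0" "p + 1 / y \<in> S"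
    then have "y \<in> f ` S" using fg by (metis imageI)
    then show False using \<open>y \<in> T\<close> connected_component_subset[of "- f ` S" "f z"] by (auto simp: T_def)
  qed
  moreover have "z \<in> ?G" using fzT gf[OF zp] by (metis imageI)
  ultimately have out: "p + 1 / y \<in> outside S" if "y \<in> T - {0}" for y
    using that outside_same_component[of S z] assms(3) connected_component_of_subset connected_componentI by (metis imageI)
  have "open (inside S)" using assms(1) by (simp add: compact_imp_closed open_inside)
  then obtain d where d: "d > 0" "ball p d \<subseteq> inside S" using assms(2) open_contains_ball by metis
  have "norm y \<le> 1 / d" if "y \<in> T" for y
  proof (cases "y = 0")
    case False
    then have "p + 1 / y \<notin> ball p d" using out[of y] that d(2) inside_Int_outside[of S] by blast
    then have "d \<le> 1 / norm y" by (simp add: dist_norm norm_divide)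
    then show ?thesis using d(1) False by (simp add: field_simps)
  qed (use d in auto)
  then have "bounded T" by (auto simp: bounded_iff)
  then show ?thesis using fzS unfolding inside_def T_def f_def by auto
qed

context plane_graph
begin

lemma path_images_Int:
  assumes "u \<noteq> v" "gpath E u F U v" "gpath E u F' U' v" "U \<inter> U' = {u, v}" "F \<inter> F' = {}"
  shows "img F \<inter> img F' = {pos u, pos v}"
proof
  note U = gpath_vertices[OF assms(2,1)] gpath_vertices[OF assms(3,1)]
  have "img F \<inter> img F' \<subseteq> pos ` (\<Union>F \<inter> \<Union>F')"
    using assms(5) gpath_subset[OF assms(2)] gpath_subset[OF assms(3)] by (intro img_Int)
  then show "img F \<inter> img F' \<subseteq> {pos u, pos v}" using U assms(4) by simp
  have "x \<in> \<Union>F" "x \<in> \<Union>F'" if "x \<in> {u, v}" for x using U assms(4) that by auto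
  then show "{pos u, pos v} \<subseteq> img F \<inter> img F'"
    using pos_in_img gpath_subset[OF assms(2)] gpath_subset[OF assms(3)] by auto
qed

text \<open>By the Jordan theorem for theta curves, the path \<open>Q\<close> divides the inside of
  the outer cycle into the insides of the two cycles through \<open>Q\<close>. That theorem needs a
  point of \<open>Q\<close> inside, which \<open>ins\<close> supplies. Open arcs of other edges are
  connected and hence fall into one of the two parts.\<close>

lemma theta_split:
  assumes uv: "u \<noteq> v" and 1: "gpath E u F1 U1 v" and 2: "gpath E u F2 U2 v" and Q: "gpath E u Q UQ v"
    and U: "U1 \<inter> U2 = {u, v}" "U1 \<inter> UQ = {u, v}" "U2 \<inter> UQ = {u, v}"
    and F: "F1 \<inter> F2 = {}" "F1 \<inter> Q = {}" "F2 \<inter> Q = {}"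
    and ins: "Q \<inter> iedges (F1 \<union> F2) \<noteq> {}"
  shows "iedges (F1 \<union> F2) = Q \<union> iedges (F1 \<union> Q) \<union> iedges (F2 \<union> Q)" (is ?A)
    and "Q \<inter> iedges (F1 \<union> Q) = {}" "Q \<inter> iedges (F2 \<union> Q) = {}" "iedges (F1 \<union> Q) \<inter> iedges (F2 \<union> Q) = {}"
    and "iverts (F1 \<union> F2) = (UQ - {u, v}) \<union> iverts (F1 \<union> Q) \<union> iverts (F2 \<union> Q)" (is ?B)
    and "UQ \<inter> iverts (F1 \<union> Q) = {}" "UQ \<inter> iverts (F2 \<union> Q) = {}" "iverts (F1 \<union> Q) \<inter> iverts (F2 \<union> Q) = {}"
proof -
  obtain a where a: "arc a" "pathstart a = pos u" "pathfinish a = pos v" "path_image a = img F1"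
    using gpath_arc[OF 1 uv] .
  obtain b where b: "arc b" "pathstart b = pos u" "pathfinish b = pos v" "path_image b = img F2"
    using gpath_arc[OF 2 uv] .
  obtain q where q: "arc q" "pathstart q = pos u" "pathfinish q = pos v" "path_image q = img Q"
    using gpath_arc[OF Q uv] .
  have img_Un: "img (A \<union> B) = img A \<union> img B" for A B by (auto simp: img_def)
  have QE: "Q \<subseteq> E" using Q gpath_subset by metis
  have UQ: "UQ = \<Union>Q" using gpath_vertices[OF Q uv] .
  have UV: "UQ \<subseteq> V" using UQ QE edge_sub by blast
  have uV: "u \<in> V" "v \<in> V" using UV gpath_start[OF Q] gpath_end[OF Q] by auto
  have puv: "pos u \<noteq> pos v" using uV uv inj_pos by (metis inj_onD)
  obtain e0 where "e0 \<in> Q" "eint e0 \<subseteq> inside (img (F1 \<union> F2))" "e0 \<in> E" using ins by (auto simp: iedges_def)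
  then have ne: "path_image q \<inter> inside (path_image a \<union> path_image b) \<noteq> {}"
    using eint_Int[of e0 "img Q"] eint_in_img[of e0 Q] q a b img_Un by metis
  define I1 I2 where "I1 = inside (img (F1 \<union> Q))" and "I2 = inside (img (F2 \<union> Q))"
  have S: "I1 \<inter> I2 = {}" "I1 \<union> I2 \<union> (img Q - {pos u, pos v}) = inside (img (F1 \<union> F2))"
    using split_inside_simple_closed_curve[OF arc_imp_simple_path[OF a(1)] a(2,3) arc_imp_simple_path[OF b(1)] b(2,3)
        arc_imp_simple_path[OF q(1)] q(2,3) puv _ _ _ ne]
      path_images_Int[OF uv 1 2 U(1) F(1)] path_images_Int[OF uv 1 Q U(2) F(2)] path_images_Int[OF uv 2 Q U(3) F(3)]
    unfolding a(4) b(4) q(4) I1_def I2_def img_Un by auto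
  have C1: "cycle E (F1 \<union> Q) (U1 \<union> UQ)" and C2: "cycle E (F2 \<union> Q) (U2 \<union> UQ)"
    using cycle_atI[OF uv 1 Q U(2) F(2)] cycle_atI[OF uv 2 Q U(3) F(3)] cycle_def by metis+
  have op: "open I1" "open I2"
    using cycle_curve[OF C1] cycle_curve[OF C2] Jordan_inside_outside unfolding I1_def I2_def by metis+
  show d1: "Q \<inter> iedges (F1 \<union> Q) = {}" using edges_partition(2)[OF C1] by auto
  show d2: "Q \<inter> iedges (F2 \<union> Q) = {}" using edges_partition(2)[OF C2] by auto
  show "UQ \<inter> iverts (F1 \<union> Q) = {}" using verts_partition(2)[OF C1] by auto
  show "UQ \<inter> iverts (F2 \<union> Q) = {}" using verts_partition(2)[OF C2] by auto
  show "iedges (F1 \<union> Q) \<inter> iedges (F2 \<union> Q) = {}"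
  proof (rule ccontr)
    assume "iedges (F1 \<union> Q) \<inter> iedges (F2 \<union> Q) \<noteq> {}"
    then obtain e where "e \<in> E" "eint e \<subseteq> I1" "eint e \<subseteq> I2" unfolding iedges_def I1_def I2_def by auto
    then show False using eint_Int S(1) by metis
  qed
  show "iverts (F1 \<union> Q) \<inter> iverts (F2 \<union> Q) = {}" using S(1) unfolding iverts_def I1_def I2_def by auto
  show ?A
  proof (intro equalityI subsetI)
    fix e assume e: "e \<in> iedges (F1 \<union> F2)"
    then have eE: "e \<in> E" and ei: "eint e \<subseteq> inside (img (F1 \<union> F2))" by (auto simp: iedges_def)
    show "e \<in> Q \<union> iedges (F1 \<union> Q) \<union> iedges (F2 \<union> Q)"
    proof (cases "e \<in> Q")
      case False
      then have "eint e \<inter> img Q = {}" using eint_img eE QE by metis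
      then have "eint e \<subseteq> I1 \<union> I2" using ei S(2) by auto
      then have "eint e \<subseteq> I1 \<or> eint e \<subseteq> I2"
        using op S(1) eE by (intro connected_subset_open_Un eint_connected)
      then show ?thesis using eE unfolding iedges_def I1_def I2_def by auto
    qed auto
  next
    fix e assume "e \<in> Q \<union> iedges (F1 \<union> Q) \<union> iedges (F2 \<union> Q)"
    then consider "e \<in> Q" | "e \<in> E" "eint e \<subseteq> I1" | "e \<in> E" "eint e \<subseteq> I2"
      unfolding iedges_def I1_def I2_def by auto
    then show "e \<in> iedges (F1 \<union> F2)"
    proof cases
      case 1
      then have "e \<in> E" "pos u \<notin> eint e" "pos v \<notin> eint e" using QE eint_pos uV by auto
      then show ?thesis using eint_in_img[OF 1] S(2) unfolding iedges_def by auto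
    qed (use S(2) in \<open>auto simp: iedges_def\<close>)
  qed
  show ?B
  proof (intro equalityI subsetI)
    fix x assume "x \<in> iverts (F1 \<union> F2)"
    then have x: "x \<in> V" "pos x \<in> I1 \<union> I2 \<union> (img Q - {pos u, pos v})" by (auto simp: iverts_def S(2))
    then show "x \<in> (UQ - {u, v}) \<union> iverts (F1 \<union> Q) \<union> iverts (F2 \<union> Q)"
      using pos_img[OF x(1) QE] unfolding UQ iverts_def I1_def I2_def by auto
  next
    fix x assume "x \<in> (UQ - {u, v}) \<union> iverts (F1 \<union> Q) \<union> iverts (F2 \<union> Q)"
    then consider "x \<in> UQ" "x \<noteq> u" "x \<noteq> v" | "x \<in> V" "pos x \<in> I1 \<union> I2"
      unfolding iverts_def I1_def I2_def by auto
    then show "x \<in> iverts (F1 \<union> F2)"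
    proof cases
      case 1
      then have "x \<in> V" "pos x \<in> img Q" using UV pos_in_img[of x Q] QE UQ by auto
      moreover have "pos x \<noteq> pos u" "pos x \<noteq> pos v" using 1 uV \<open>x \<in> V\<close> inj_pos by (metis inj_onD)+
      ultimately show ?thesis using S(2) unfolding iverts_def by auto
    qed (use S(2) in \<open>auto simp: iverts_def\<close>)
  qed
qed

section \<open>Drawings under injective continuous maps and inversions\<close>

lemma plane_graph_image:
  assumes "continuous_on S f" "inj_on f S" "img E \<subseteq> S" "pos ` V \<subseteq> S"
  shows "plane_graph V E (f \<circ> pos) (\<lambda>e. f \<circ> crv e)"
proof
  have sub: "path_image (crv e) \<subseteq> S" if "e \<in> E" for e using assms(3) that unfolding img_def by blast
  have imI: "f ` A \<inter> f ` B = f ` (A \<inter> B)" if "A \<subseteq> S" "B \<subseteq> S" for A B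
    using inj_on_image_Int[OF assms(2) that] by simp
  have "arc (f \<circ> crv e)" if "e \<in> E" for e
  proof -
    have "arc (crv e)" "path_image (crv e) \<subseteq> S" using that sub arc_crv by auto
    then show ?thesis unfolding arc_def path_def path_image_def
      using assms(1,2) by (metis comp_inj_on continuous_on_compose continuous_on_subset inj_on_subset)
  qed
  moreover have "{pathstart (f \<circ> crv e), pathfinish (f \<circ> crv e)} = (f \<circ> pos) ` e" if "e \<in> E" for e
    using arg_cong[OF ends_crv[OF that], of "image f"]
    by (simp add: pathstart_compose pathfinish_compose image_comp)
  moreover have "path_image (f \<circ> crv e) \<inter> (f \<circ> pos) ` V = (f \<circ> pos) ` e" if "e \<in> E" for e
    using imI[OF sub[OF that] assms(4)] crv_pos[OF that] by (simp add: path_image_compose image_comp)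
  moreover have "path_image (f \<circ> crv e) \<inter> path_image (f \<circ> crv e') = (f \<circ> pos) ` (e \<inter> e')"
    if "e \<in> E" "e' \<in> E" "e \<noteq> e'" for e e'
    using imI[OF sub[OF that(1)] sub[OF that(2)]] crv_crv[OF that] by (simp add: path_image_compose image_comp)
  moreover have "inj_on (f \<circ> pos) V" using inj_pos assms(2,4) by (metis comp_inj_on inj_on_subset)
  ultimately show "drawn_in UNIV V E (f \<circ> pos) (\<lambda>e. f \<circ> crv e)" by (simp add: drawn_in_def)
qed (rule simple)

text \<open>Nothing is drawn inside \<open>C\<close>, so the inversion at \<open>p\<close> is
  injective and continuous on the drawing. It sends the outside of \<open>C\<close> to the inside of
  the image curve.\<close>

lemma oedges_invert:
  assumes "cycle E C W" "E = C \<union> oedges C" "V = W \<union> overts C" "p \<in> inside (img C)"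
  defines "f \<equiv> \<lambda>z. 1 / (z - p)"
  shows "plane_graph V E (f \<circ> pos) (\<lambda>e. f \<circ> crv e)"
    and "plane_graph.iedges E (f \<circ> pos) (\<lambda>e. f \<circ> crv e) C = oedges C"
    and "plane_graph.iverts V (f \<circ> pos) (\<lambda>e. f \<circ> crv e) C = overts C"
proof -
  have CE: "C \<subseteq> E" "W = \<Union>C" using assms(1) cycle_subset cycle_vertices by metis+
  have img_out: "path_image (crv e) \<subseteq> - {p}" if "e \<in> E" for e
  proof (cases "e \<in> C")
    case True
    then have "path_image (crv e) \<subseteq> img C" by (auto simp: img_def)
    then show ?thesis using assms(4) inside_no_overlap[of "img C"] by blast
  next
    case False
    then have o: "eint e \<subseteq> outside (img C)" using that assms(2) by (auto simp: oedges_def)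
    obtain c where c: "simple_path c" "pathfinish c = pathstart c" "path_image c = img C"
      using cycle_curve[OF assms(1)] .
    \<comment> \<open>The ends of an outer edge are limits of its open arc, so they cannot lie in
      the open set inside \<open>C\<close>.\<close>
    have "open (inside (img C))" using Jordan_inside_outside[OF c(1,2), unfolded c(3)] by simp
    moreover have "inside (img C) \<inter> eint e = {}" using o inside_Int_outside[of "img C"] by blast
    ultimately have "inside (img C) \<inter> closure (eint e) = {}" using open_Int_closure_eq_empty by metis
    then show ?thesis using closure_eint[OF that] assms(4) by blast
  qed
  have pos_out: "pos ` V \<subseteq> - {p}"
  proof -
    have "pos x \<noteq> p" if "x \<in> V" for x
    proof -
      have "pos x \<notin> inside (img C)"
        using that verts_partition[OF assms(1)] assms(3) by (auto simp: iverts_def)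
      then show ?thesis using assms(4) by auto
    qed
    then show ?thesis by auto
  qed
  have inj: "inj_on f (- {p})" by (auto simp: inj_on_def f_def)
  have imgE: "img E \<subseteq> - {p}" using img_out by (auto simp: img_def)
  show G: "plane_graph V E (f \<circ> pos) (\<lambda>e. f \<circ> crv e)"
    using pos_out imgE inj by (intro plane_graph_image[of "- {p}"]) (auto simp: f_def intro!: continuous_intros)
  interpret G: plane_graph V E "f \<circ> pos" "\<lambda>e. f \<circ> crv e" by fact
  have "compact (img C)"
    using cycle_curve[OF assms(1)] compact_simple_path_image by metis
  then have inv: "f z \<in> inside (f ` img C)" if "z \<in> outside (img C)" for z
    unfolding f_def using inversion_outside_inside assms(4) that by metis
  have Gimg: "G.img C = f ` img C" by (auto simp: G.img_def img_def path_image_compose)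
  have Geint: "G.eint e = f ` eint e" if "e \<in> E" for e
  proof -
    have "path_image (crv e) \<subseteq> - {p}" "pos ` e \<subseteq> - {p}" using img_out[OF that] pos_in_crv[OF that] by auto
    then show ?thesis using inj_on_image_set_diff[OF inj, of "path_image (crv e)" "pos ` e"]
      by (simp add: G.eint_def eint_def path_image_compose image_comp Diff_subset)
  qed
  have "oedges C \<subseteq> G.iedges C"
  proof
    fix e assume "e \<in> oedges C"
    then have "e \<in> E" "eint e \<subseteq> outside (img C)" by (auto simp: oedges_def)
    moreover from this have "f ` eint e \<subseteq> inside (f ` img C)" using inv by blast
    ultimately show "e \<in> G.iedges C" using Geint by (simp add: G.iedges_def Gimg)
  qed
  \<comment> \<open>The reverse inclusion needs no geometry: inside edges are not in
    \<open>C\<close>, and every edge is in \<open>C\<close> or in \<open>oedges C\<close>.\<close>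
  moreover have "G.iedges C \<subseteq> E" "G.iedges C \<inter> C = {}"
    using G.edges_partition[OF assms(1)] by auto
  ultimately show "G.iedges C = oedges C" using assms(2) by blast
  have "overts C \<subseteq> G.iverts C"
    using inv unfolding overts_def G.iverts_def Gimg by auto
  moreover have "G.iverts C \<subseteq> V" "G.iverts C \<inter> W = {}"
    using G.verts_partition[OF assms(1)] by auto
  ultimately show "G.iverts C = overts C" using assms(3) by blast
qed

end

subsection \<open>The weighted Euler inequality\<close>

text \<open>The path to \<open>z\<close> is prolonged one edge at a time along the second path by
  \<open>gpath_extend\<close>, which shortcuts at vertices already visited. So the two paths may
  intersect arbitrarily.\<close>

lemma gpath_connect:
  assumes "gpath E z F' U' t" "gpath E y F U z"
  shows "\<exists>F'' U''. gpath E y F'' U'' t \<and> U'' \<subseteq> U \<union> U'"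
  using assms
proof (induction arbitrary: F U rule: gpath.induct)
  case (gpath_refl u)
  then show ?case by blast
next
  case (gpath_step u v U' F' w)
  obtain F1 U1 where 1: "gpath E y F1 U1 v" "U1 \<subseteq> insert v U"
    using gpath_extend[OF gpath_step.prems gpath_step.hyps(1)] by metis
  obtain F2 U2 where "gpath E y F2 U2 w" "U2 \<subseteq> U1 \<union> U'" using gpath_step.IH[OF 1(1)] by blast
  moreover from this(2) have "U2 \<subseteq> U \<union> insert u U'" using 1(2) gpath_start[OF gpath_step.hyps(3)] by auto
  ultimately show ?case by blast
qed

text \<open>For the constant weight 1 the second condition says that the girth is at least
  \<open>g\<close>.\<close>

definition heavy :: "('a set \<Rightarrow> real) \<Rightarrow> real \<Rightarrow> 'a set set \<Rightarrow> bool" where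
  "heavy w g E \<longleftrightarrow> (\<forall>e\<in>E. 0 \<le> w e) \<and> (\<forall>C W. cycle E C W \<longrightarrow> g \<le> sum w C)"

lemma heavy_subset: "heavy w g E \<Longrightarrow> E' \<subseteq> E \<Longrightarrow> heavy w g E'"
  unfolding heavy_def by (metis cycle_mono cycle_subset subsetD subset_trans)

section \<open>Face counting on the two sides of a cycle\<close>

context plane_graph
begin

text \<open>An end of an edge lies in the closure of its open arc, and an open side of
  \<open>C\<close> that meets this closure also meets the arc.\<close>

lemma iverts_oedges:
  assumes "cycle E C W" "e \<in> E" "x \<in> e"
  shows "e \<in> oedges C \<Longrightarrow> x \<notin> iverts C" and "e \<in> iedges C \<Longrightarrow> x \<notin> overts C"
proof -
  obtain c where c: "simple_path c" "pathfinish c = pathstart c" "path_image c = img C"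
    using cycle_curve[OF assms(1)] .
  have op: "open (inside (img C))" "open (outside (img C))"
    using Jordan_inside_outside[OF c(1,2), unfolded c(3)] by auto
  have x: "pos x \<in> closure (eint e)" using closure_eint pos_in_crv assms by blast
  show "x \<notin> iverts C" if "e \<in> oedges C"
  proof
    assume "x \<in> iverts C"
    then have "inside (img C) \<inter> closure (eint e) \<noteq> {}" using x by (auto simp: iverts_def)
    then have "inside (img C) \<inter> eint e \<noteq> {}" using op open_Int_closure_eq_empty by metis
    then show False using that inside_Int_outside[of "img C"] unfolding oedges_def by blast
  qed
  show "x \<notin> overts C" if "e \<in> iedges C"
  proof
    assume "x \<in> overts C"
    then have "outside (img C) \<inter> closure (eint e) \<noteq> {}" using x by (auto simp: overts_def)
    then have "outside (img C) \<inter> eint e \<noteq> {}" using op open_Int_closure_eq_empty by metis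
    then show False using that inside_Int_outside[of "img C"] unfolding iedges_def by blast
  qed
qed

lemma iverts_edge:
  assumes "cycle E C W" "e \<in> E" "x \<in> e" "x \<in> iverts C"
  shows "e \<in> iedges C"
proof -
  have "x \<notin> W" using verts_partition(2)[OF assms(1)] assms(4) by auto
  then have "e \<notin> C" using cycle_vertices[OF assms(1)] assms(3) by auto
  moreover have "e \<notin> oedges C" using iverts_oedges(1)[OF assms(1-3)] assms(4) by auto
  ultimately show ?thesis using edges_partition(1)[OF assms(1)] assms(2) by auto
qed

text \<open>If \<open>C\<close> and its inside form a connected graph, the factor of
  \<open>g\<close> is the number of bounded faces by Euler's formula, as \<open>C\<close> has
  equally many edges and vertices. Each face contributes weight at least \<open>g\<close>; inside
  edges border two of these faces, edges of \<open>C\<close> one.\<close>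

definition "inside_ok w g C \<longleftrightarrow> 
  g * (real (card (iedges C)) - real (card (iverts C)) + 1) \<le> 2 * sum w (iedges C) + sum w C"

lemma card_partition:
  assumes "cycle E C W"
  shows "card E = card C + card (iedges C) + card (oedges C)"
    and "card V = card W + card (iverts C) + card (overts C)"
    and "sum w E = sum w C + sum w (iedges C) + sum w (oedges C)"
proof -
  note e = edges_partition[OF assms] and v = verts_partition[OF assms]
  have fin: "finite C" "finite (iedges C)" "finite (oedges C)" "finite W" "finite (iverts C)" "finite (overts C)"
    using finite_E finite_V cycle_finite[OF assms] by (simp_all add: iedges_def oedges_def iverts_def overts_def)
  have E: "C \<inter> iedges C = {}" "(C \<union> iedges C) \<inter> oedges C = {}" using e by auto
  have V: "W \<inter> iverts C = {}" "(W \<union> iverts C) \<inter> overts C = {}" using v by auto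
  have "card E = card (C \<union> iedges C \<union> oedges C)" using e(1) by simp
  then show "card E = card C + card (iedges C) + card (oedges C)"
    using E fin by (simp add: card_Un_disjoint)
  have "card V = card (W \<union> iverts C \<union> overts C)" using v(1) by simp
  then show "card V = card W + card (iverts C) + card (overts C)"
    using V fin by (simp add: card_Un_disjoint)
  have "sum w E = sum w (C \<union> iedges C \<union> oedges C)" using e(1) by simp
  then show "sum w E = sum w C + sum w (iedges C) + sum w (oedges C)"
    using E fin by (simp add: sum.union_disjoint)
qed

text \<open>
  The outside of \<open>C\<close> becomes the inside under an inversion centred inside \<open>C\<close>. The hypothesis
  \<open>IH\<close> ranges over all drawings because the inversion changes the drawing.
\<close>

lemma euler_from_inside:
  fixes w :: "'a set \<Rightarrow> real"
  assumes C: "cycle E C W" and h: "heavy w g E" and g: "g \<ge> 0"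
    and IH: "\<And>V' (E' :: 'a set set) pos' crv' C' W'. plane_graph V' E' pos' crv' \<Longrightarrow> cycle E' C' W' \<Longrightarrow> heavy w g E' \<Longrightarrow>
      card (plane_graph.iedges E' pos' crv' C') < card E \<Longrightarrow> plane_graph.inside_ok V' E' pos' crv' w g C'"
  shows "g * (real (card E) - real (card V) + 2) \<le> 2 * sum w E"
proof -
  note cp = card_partition[OF C]
  \<comment> \<open>As \<open>C\<close> has an edge, fewer than \<open>card E\<close> edges lie on
    either side, which is the bound that \<open>IH\<close> demands.\<close>
  have C0: "card C > 0" using cycle_nonempty[OF C] cycle_finite[OF C] by (simp add: card_gt_0_iff)
  have "inside_ok w g C" using C h cp(1) C0 by (intro IH) (auto intro: plane_graph_axioms)
  then have 1: "g * (real (card (iedges C)) - real (card (iverts C)) + 1) \<le> 2 * sum w (iedges C) + sum w C"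
    by (simp add: inside_ok_def)
  \<comment> \<open>Only \<open>C\<close> and its outside are kept, which clears the inside for the
    centre of the inversion.\<close>
  define V' where "V' = W \<union> overts C"
  define E' where "E' = C \<union> oedges C"
  have CE: "C \<subseteq> E" "W = \<Union>C" using C cycle_subset cycle_vertices by metis+
  have EE: "E' \<subseteq> E" using CE(1) by (auto simp: E'_def oedges_def)
  have VV: "V' \<subseteq> V" using verts_partition(1)[OF C] by (auto simp: V'_def)
  have "plane_graph V' E' pos crv"
  proof (rule subgraph[OF VV EE])
    fix e assume e: "e \<in> E'"
    show "e \<subseteq> V'"
    proof (cases "e \<in> C")
      case False
      then have "e \<in> oedges C" "e \<in> E" using e EE by (auto simp: E'_def)
      then have "x \<notin> iverts C" "x \<in> V" if "x \<in> e" for x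
        using iverts_oedges(1)[OF C _ that] edge_sub that by auto
      then show ?thesis using verts_partition(1)[OF C] by (auto simp: V'_def)
    qed (use CE in \<open>auto simp: V'_def\<close>)
  qed
  then interpret G: plane_graph V' E' pos crv .
  have CG: "cycle E' C W" using cycle_mono[OF C] by (simp add: E'_def)
  have oG: "G.oedges C = oedges C" using EE
    by (auto simp: oedges_def G.oedges_def) (auto simp: E'_def oedges_def)
  have ovG: "G.overts C = overts C" using VV
    by (auto simp: overts_def G.overts_def) (auto simp: V'_def overts_def)
  obtain c where c: "simple_path c" "pathfinish c = pathstart c" "path_image c = img C"
    using cycle_curve[OF C] .
  then obtain p where p: "p \<in> inside (img C)" using Jordan_inside_outside[OF c(1,2), unfolded c(3)] by auto
  note inv = G.oedges_invert[OF CG _ _ p, unfolded oG ovG, OF E'_def V'_def]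
  interpret H: plane_graph V' E' "(\<lambda>z. 1 / (z - p)) \<circ> pos" "\<lambda>e. (\<lambda>z. 1 / (z - p)) \<circ> crv e"
    using inv(1) .
  have "H.inside_ok w g C"
    using CG heavy_subset[OF h EE] cp(1) C0 inv(2) by (intro IH) (auto intro: H.plane_graph_axioms)
  then have 2: "g * (real (card (oedges C)) - real (card (overts C)) + 1) \<le> 2 * sum w (oedges C) + sum w C"
    by (simp add: H.inside_ok_def inv)
  \<comment> \<open>\<open>C\<close> has equally many edges and vertices, so they cancel, and the
    terms 1 of the two sides add up to 2.\<close>
  have "g * (real (card E) - real (card V) + 2) = g * (real (card (iedges C)) - real (card (iverts C)) + 1) +
     g * (real (card (oedges C)) - real (card (overts C)) + 1)"
    using cp(1,2) cycle_card[OF C] by (simp flip: distrib_left)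
  then show ?thesis using 1 2 cp(3)[of w] by linarith
qed

lemma forest_or_cycle:
  assumes "V \<noteq> {}" "\<nexists>C W. cycle E C W"
  shows "card E + 1 \<le> card V"
proof (rule forest_card[OF simple assms(1)], intro allI impI notI)
  fix C assume "C \<subseteq> E" and l: "leafless C"
  then have "finite (\<Union>C)" "\<forall>e\<in>C. card e = 2"
    using finite_V edge_sub edge_card by (auto intro!: finite_subset[of _ V])
  then obtain D W where "cycle C D W" using leafless_cycle[OF l] by auto
  then have "cycle E D W" using cycle_mono cycle_subset \<open>C \<subseteq> E\<close> by (metis subset_trans)
  then show False using assms(2) by blast
qed

text \<open>With 1 in place of 2 the inequality also covers forests, where the left side is at most
  0. It is applied to a piece of the graph that may have no cycle.\<close>

lemma euler_weak_from_inside: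
  fixes w :: "'a set \<Rightarrow> real"
  assumes "V \<noteq> {}" and h: "heavy w g E" and g: "g \<ge> 0"
    and IH: "\<And>V' (E' :: 'a set set) pos' crv' C' W'. plane_graph V' E' pos' crv' \<Longrightarrow> cycle E' C' W' \<Longrightarrow> heavy w g E' \<Longrightarrow>
      card (plane_graph.iedges E' pos' crv' C') < card E \<Longrightarrow> plane_graph.inside_ok V' E' pos' crv' w g C'"
  shows "g * (real (card E) - real (card V) + 1) \<le> 2 * sum w E"
proof (cases "\<exists>C W. cycle E C W")
  case True
  then obtain C W where C: "cycle E C W" by blast
  have "g * (real (card E) - real (card V) + 2) \<le> 2 * sum w E"
    by (rule euler_from_inside[OF C h g]) (rule IH)
  then show ?thesis using g by (simp add: algebra_simps)
next
  case False
  then have "card E + 1 \<le> card V" using forest_or_cycle assms(1) by blast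
  then have "g * (real (card E) - real (card V) + 1) \<le> 0" using g by (intro mult_nonneg_nonpos) auto
  moreover have "sum w E \<ge> 0" using h by (auto simp: heavy_def intro: sum_nonneg)
  ultimately show ?thesis by simp
qed

text \<open>The ear \<open>Q\<close> splits the inside of \<open>C\<close> into the insides of two
  cycles with fewer inside edges. In the sum of their inequalities \<open>Q\<close> is counted
  twice, once in each cycle, just as the inequality for \<open>C\<close> counts its inside
  edges.\<close>

lemma ear_step:
  fixes w :: "'a set \<Rightarrow> real"
  assumes C: "cycle E C W" and h: "heavy w g E" and g: "g \<ge> 0"
    and uv: "u \<noteq> v" and Q: "gpath E u Q UQ v" "UQ \<inter> W = {u, v}" "Q \<inter> C = {}" "Q \<inter> iedges C \<noteq> {}"
    and IH: "\<And>C' W'. cycle E C' W' \<Longrightarrow> card (iedges C') < card (iedges C) \<Longrightarrow> inside_ok w g C'"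
  shows "inside_ok w g C"
proof -
  have "u \<in> W" "v \<in> W" using Q(2) by auto
  then have "cycle_at E u v C W" using cycle_at_any[OF C] uv by metis
  then show ?thesis
  proof (cases rule: cycle_atE)
    case (1 F1 U1 F2 U2)
    have end1: "u \<in> U1" "v \<in> U1" using gpath_start[OF 1(2)] gpath_end[OF 1(2)] .
    have end2: "u \<in> U2" "v \<in> U2" using gpath_start[OF 1(3)] gpath_end[OF 1(3)] .
    have U: "U1 \<inter> UQ = {u, v}" "U2 \<inter> UQ = {u, v}" using Q(2) end1 end2 1(7) by blast+
    have F: "F1 \<inter> Q = {}" "F2 \<inter> Q = {}" using Q(3) 1(6) by auto
    have ne: "Q \<inter> iedges (F1 \<union> F2) \<noteq> {}" using Q(4) 1(6) by simp
    note S = theta_split[OF uv 1(2,3) Q(1) 1(4) U 1(5) F ne]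
    have C1: "cycle E (F1 \<union> Q) (U1 \<union> UQ)" and C2: "cycle E (F2 \<union> Q) (U2 \<union> UQ)"
      using cycle_atI[OF uv 1(2) Q(1) U(1) F(1)] cycle_atI[OF uv 1(3) Q(1) U(2) F(2)] cycle_def by metis+
    define I1 I2 J1 J2 where "I1 = iedges (F1 \<union> Q)" and "I2 = iedges (F2 \<union> Q)"
      and "J1 = iverts (F1 \<union> Q)" and "J2 = iverts (F2 \<union> Q)"
    note defs = I1_def[symmetric] I2_def[symmetric] J1_def[symmetric] J2_def[symmetric]
    note S = S[unfolded defs 1(6)[symmetric]]
    have fin: "finite I1" "finite I2" "finite J1" "finite J2" "finite Q" "finite UQ" "finite F1" "finite F2"
      using finite_E finite_V gpath_finite[OF Q(1)] gpath_finite[OF 1(2)] gpath_finite[OF 1(3)]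
      by (simp_all add: I1_def I2_def J1_def J2_def iedges_def iverts_def)
    have cI: "card (iedges C) = card Q + card I1 + card I2" "sum w (iedges C) = sum w Q + sum w I1 + sum w I2"
      using S(1-4) fin by (simp_all add: card_Un_disjoint sum.union_disjoint Int_Un_distrib2)
    have d: "(UQ - {u, v}) \<inter> J1 = {}" "(UQ - {u, v}) \<inter> J2 = {}" using S(6,7) by auto
    have "card (iverts C) = card (UQ - {u, v}) + card J1 + card J2"
      using S(5,8) d fin by (simp add: card_Un_disjoint Int_Un_distrib2)
    moreover have "card (UQ - {u, v}) + 2 = card UQ"
    proof -
      have "{u, v} \<subseteq> UQ" using gpath_start[OF Q(1)] gpath_end[OF Q(1)] by simp
      then show ?thesis using fin(6) uv card_Diff_subset[of "{u, v}" UQ] card_mono[of UQ "{u, v}"] by simp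
    qed
    \<comment> \<open>The ear adds one inner vertex less than edges; this accounts for the
      additional 1 when the two inequalities are added.\<close>
    ultimately have cV: "real (card (iverts C)) = real (card Q) - 1 + real (card J1) + real (card J2)"
      using gpath_card[OF Q(1)] by linarith
    have "card Q > 0" using Q(4) fin(5) by (auto simp: card_gt_0_iff)
    then have "inside_ok w g (F1 \<union> Q)" "inside_ok w g (F2 \<union> Q)"
      using cI(1) by (auto intro!: IH[OF C1] IH[OF C2] simp: defs)
    then have "g * (real (card I1) - real (card J1) + 1) \<le> 2 * sum w I1 + (sum w F1 + sum w Q)"
      "g * (real (card I2) - real (card J2) + 1) \<le> 2 * sum w I2 + (sum w F2 + sum w Q)"
      using F fin by (simp_all add: inside_ok_def defs sum.union_disjoint)
    moreover have "sum w C = sum w F1 + sum w F2" using 1(5,6) fin by (simp add: sum.union_disjoint)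
    moreover have "g * (real (card (iedges C)) - real (card (iverts C)) + 1) =
       g * (real (card I1) - real (card J1) + 1) + g * (real (card I2) - real (card J2) + 1)"
      using cI(1) cV by (simp flip: distrib_left)
    ultimately show ?thesis unfolding inside_ok_def cI(2) by (simp only: distrib_left)
  qed
qed

end

text \<open>
  If no path inside \<open>C\<close> joins two vertices of \<open>C\<close>, then a component \<open>R\<close> of the graph inside \<open>C\<close> has
  at most one neighbour on \<open>C\<close>. It is cut off and bounded by the weak form of Euler's inequality.
\<close>

lemma inside_bound:
  fixes w :: "'a set \<Rightarrow> real" and V :: "'a set"
  assumes "plane_graph V E pos crv" "cycle E C W" "heavy w g E" "g \<ge> 0"
  shows "plane_graph.inside_ok V E pos crv w g C"
  using assms
proof (induction "card (plane_graph.iedges E pos crv C)" arbitrary: V E pos crv C W rule: less_induct)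
  case less
  interpret plane_graph V E pos crv by fact
  note C = \<open>cycle E C W\<close> and h = \<open>heavy w g E\<close> and g = \<open>g \<ge> 0\<close>
  have IH: "plane_graph.inside_ok V' E' pos' crv' w g C'"
    if "plane_graph V' E' pos' crv'" "cycle E' C' W'" "heavy w g E'"
      "card (plane_graph.iedges E' pos' crv' C') < card (iedges C)" for V' :: "'a set" and E' pos' crv' C' W'
    using less.hyps[OF that(4) that(1-3) g] .
  have finI: "finite (iedges C)" "finite (iverts C)" using finite_E finite_V by (simp_all add: iedges_def iverts_def)
  consider "iedges C = {}"
    | u v Q UQ where "u \<noteq> v" "gpath E u Q UQ v" "UQ \<inter> W = {u, v}" "Q \<inter> C = {}" "Q \<inter> iedges C \<noteq> {}"
    | e0 where "e0 \<in> iedges C"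
      "\<And>u v Q UQ. u \<noteq> v \<Longrightarrow> gpath E u Q UQ v \<Longrightarrow> UQ \<inter> W = {u, v} \<Longrightarrow> Q \<inter> C = {} \<Longrightarrow> Q \<inter> iedges C = {}"
    by (metis ex_in_conv)
  then show ?case
  proof cases
    case 1
    \<comment> \<open>With no edges inside, the only face to pay for is the one bounded by
      \<open>C\<close>; isolated vertices inside lower the left side.\<close>
    have "g \<le> sum w C" using h C by (auto simp: heavy_def)
    moreover have "g * real (card (iverts C)) \<ge> 0" using g by simp
    ultimately show ?thesis using 1 by (simp add: inside_ok_def algebra_simps)
  next
    case (2 u v Q UQ)
    show ?thesis
    proof (rule ear_step[OF C h g 2])
      fix C' W' assume "cycle E C' W'" "card (iedges C') < card (iedges C)"
      then show "inside_ok w g C'" using IH h plane_graph_axioms by blast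
    qed
  next
    case 3
    note noear = 3(2)
    have WC: "W = \<Union>C" using cycle_vertices[OF C] .
    have Wi: "W \<inter> iverts C = {}" using verts_partition(2)[OF C] .
    have e0: "e0 \<in> E" using 3(1) by (simp add: iedges_def)
    have iE: "iedges C \<inter> C = {}" using edges_partition(2)[OF C] by auto
    have Wiv: "y \<in> W \<or> y \<in> iverts C" if "e \<in> iedges C" "y \<in> e" for e y
    proof -
      have "e \<in> E" using that(1) by (simp add: iedges_def)
      then have "y \<in> V" "y \<notin> overts C" using that edge_sub iverts_oedges(2)[OF C] by auto
      then show ?thesis using verts_partition(1)[OF C] by auto
    qed
    \<comment> \<open>Otherwise \<open>e0\<close> joins two vertices of \<open>C\<close> and is
      itself an ear.\<close>
    have "\<exists>x\<in>e0. x \<in> iverts C"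
    proof (rule ccontr)
      assume no: "\<not> (\<exists>x\<in>e0. x \<in> iverts C)"
      obtain a b where ab: "e0 = {a, b}" "a \<noteq> b" using edge_card[OF e0] by (meson card_2_iff)
      then have "a \<in> W" "b \<in> W" using Wiv[OF 3(1)] no by auto
      moreover have "gpath E a {e0} {a, b} b" using gpath_edge ab e0 by metis
      moreover have "{e0} \<inter> C = {}" using iE 3(1) by auto
      ultimately have "{e0} \<inter> iedges C = {}" using noear[of a b "{e0}" "{a, b}"] ab(2) by auto
      then show False using 3(1) by simp
    qed
    then obtain x where x: "x \<in> e0" "x \<in> iverts C" by blast
    \<comment> \<open>\<open>R\<close> is the component of \<open>x\<close> among the vertices
      inside \<open>C\<close>, \<open>Q\<close> consists of all edges at \<open>R\<close>, and
      \<open>A\<close> collects the neighbours of \<open>R\<close> on \<open>C\<close>.\<close>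
    define R where "R = {y. \<exists>F U. gpath E x F U y \<and> U \<subseteq> iverts C}"
    define Q where "Q = {e \<in> E. e \<inter> R \<noteq> {}}"
    define A where "A = \<Union>Q - R"
    have xR: "x \<in> R" using x gpath_refl[of E x] by (auto simp: R_def)
    have Ri: "R \<subseteq> iverts C" using gpath_end by (fastforce simp: R_def)
    have QI: "Q \<subseteq> iedges C" using iverts_edge[OF C] Ri by (auto simp: Q_def)
    have AW: "A \<subseteq> W"
    proof
      fix y assume "y \<in> A"
      then obtain e r where e: "e \<in> E" "r \<in> e" "r \<in> R" "y \<in> e" "y \<notin> R" by (auto simp: A_def Q_def)
      then have ery: "e = {r, y}" using edge_card[OF e(1)] by (metis card_2_iff doubleton_eq_iff insertE singletonD)
      have "y \<notin> iverts C"
      proof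
        assume yi: "y \<in> iverts C"
        obtain F U where "gpath E x F U r" "U \<subseteq> iverts C" using e(3) by (auto simp: R_def)
        moreover obtain F' U' where "gpath E x F' U' y" "U' \<subseteq> insert y U"
          using gpath_extend[OF calculation(1)] e(1) ery by metis
        ultimately have "y \<in> R" using yi by (auto simp: R_def)
        then show False using e(5) by simp
      qed
      moreover have "e \<in> iedges C" using QI e by (auto simp: Q_def)
      ultimately show "y \<in> W" using Wiv e(4) by blast
    qed
    have nbr: "\<exists>r\<in>R. {r, y} \<in> E" if "y \<in> A" for y
    proof -
      obtain e r where e: "e \<in> E" "r \<in> e" "r \<in> R" "y \<in> e" "y \<notin> R" using \<open>y \<in> A\<close> by (auto simp: A_def Q_def)
      then have "e = {r, y}" using edge_card[OF e(1)] by (metis card_2_iff doubleton_eq_iff insertE singletonD)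
      then show ?thesis using e by auto
    qed
    have A1: "y = z" if yA: "y \<in> A" and zA: "z \<in> A" for y z
    proof (rule ccontr)
      assume yz: "y \<noteq> z"
      obtain r s where rs: "r \<in> R" "{r, y} \<in> E" "s \<in> R" "{s, z} \<in> E"
        using nbr[OF yA] nbr[OF zA] by blast
      obtain F1 U1 where 1: "gpath E x F1 U1 r" "U1 \<subseteq> iverts C" using rs(1) by (auto simp: R_def)
      obtain F2 U2 where 2: "gpath E x F2 U2 s" "U2 \<subseteq> iverts C" using rs(3) by (auto simp: R_def)
      obtain P UP where P: "gpath E r P UP s" "UP \<subseteq> U1 \<union> U2"
        using gpath_connect[OF 2(1) gpath_rev[OF 1(1)]] by metis
      have UPi: "UP \<subseteq> iverts C" using P(2) 1(2) 2(2) by auto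
      have yzW: "y \<in> W" "z \<in> W" using AW yA zA by auto
      then have yzU: "y \<notin> UP" "z \<notin> UP" using UPi Wi by auto
      \<comment> \<open>Prolonged by \<open>y\<close> and \<open>z\<close>, the path
        \<open>P\<close> through inside vertices becomes an ear, which \<open>noear\<close>
        forbids.\<close>
      have "gpath E z (insert {z, s} P) (insert z UP) r"
        using rs(4) yzU gpath_rev[OF P(1)] by (intro gpath.gpath_step) (simp_all add: insert_commute)
      then have "gpath E r (insert {z, s} P) (insert z UP) z" by (rule gpath_rev)
      then have gp: "gpath E y (insert {y, r} (insert {z, s} P)) (insert y (insert z UP)) z"
        using rs(2) yzU yz by (intro gpath.gpath_step) (simp_all add: insert_commute)
      have "UP \<inter> W = {}" using UPi Wi by auto
      then have "insert y (insert z UP) \<inter> W = {y, z}" using yzW by auto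
      moreover have "insert {y, r} (insert {z, s} P) \<inter> C = {}"
      proof -
        have eC: "e \<notin> C" if "e \<inter> iverts C \<noteq> {}" for e using that Wi WC by auto
        have "e \<notin> C" if "e \<in> P" for e
        proof (rule eC)
          have "e \<in> E" "e \<subseteq> iverts C" using that gpath_subset[OF P(1)] gpath_Union[OF P(1)] UPi by auto
          then show "e \<inter> iverts C \<noteq> {}" using edge_card[of e] by (simp add: Int_absorb2) (use card.empty in fastforce)
        qed
        moreover have "{y, r} \<notin> C" "{z, s} \<notin> C" using eC rs(1,3) Ri by auto
        ultimately show ?thesis by auto
      qed
      moreover have "{y, r} \<in> iedges C" using QI rs(1,2) by (auto simp: Q_def insert_commute)
      ultimately show False using noear[OF yz gp] by auto
    qed
    have finA: "finite A" "card A \<le> 1"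
    proof -
      have "A = {} \<or> (\<exists>y. A = {y})" using A1 by blast
      then show "finite A" "card A \<le> 1" by auto
    qed
    have fin: "finite R" "finite Q" using Ri QI finI finite_subset by metis+
    have RV: "R \<subseteq> V" using Ri by (auto simp: iverts_def)
    have QE: "Q \<subseteq> E" by (auto simp: Q_def)
    have "A \<subseteq> V" using AW verts_partition(1)[OF C] by auto
    then have GQ: "plane_graph (R \<union> A) Q pos crv"
      using RV QE by (intro subgraph) (auto simp: A_def)
    have hQ: "heavy w g Q" using heavy_subset[OF h QE] .
    have cQ: "card Q \<le> card (iedges C)" using QI finI card_mono by metis
    have "g * (real (card Q) - real (card (R \<union> A)) + 1) \<le> 2 * sum w Q"
    proof (rule plane_graph.euler_weak_from_inside[OF GQ _ hQ g])
      fix V' :: "'a set" and E' pos' crv' C' W'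
      assume "plane_graph V' E' pos' crv'" "cycle E' C' W'" "heavy w g E'"
        "card (plane_graph.iedges E' pos' crv' C') < card Q"
      then show "plane_graph.inside_ok V' E' pos' crv' w g C'" using IH cQ by (meson less_le_trans)
    qed (use xR in auto)
    \<comment> \<open>\<open>A\<close> has at most one vertex, and it uses up the term 1 of the weak
      inequality.\<close>
    moreover have "real (card (R \<union> A)) \<le> real (card R) + 1" using card_Un_le[of R A] finA by linarith
    then have "g * (real (card Q) - real (card R)) \<le> g * (real (card Q) - real (card (R \<union> A)) + 1)"
      using g by (intro mult_left_mono) auto
    ultimately have B1: "g * (real (card Q) - real (card R)) \<le> 2 * sum w Q" by linarith
    \<comment> \<open>The rest of the graph still contains \<open>C\<close> and has fewer edges
      inside it, since \<open>e0\<close> is in \<open>Q\<close>; induction applies.\<close>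
    have GR: "plane_graph (V - R) (E - Q) pos crv"
      using edge_sub by (intro subgraph) (auto simp: Q_def)
    interpret G: plane_graph "V - R" "E - Q" pos crv by (rule GR)
    have CQ: "cycle (E - Q) C W"
      using cycle_subset[OF C] QI iE by (intro cycle_mono[OF C]) auto
    have Gi: "G.iedges C = iedges C - Q" by (auto simp: G.iedges_def iedges_def)
    have Gv: "G.iverts C = iverts C - R" by (auto simp: G.iverts_def iverts_def)
    have "e0 \<in> Q" using x xR e0 by (auto simp: Q_def)
    then have "card (G.iedges C) < card (iedges C)"
      unfolding Gi using 3(1) finI by (metis DiffD2 Diff_subset psubsetI psubset_card_mono)
    then have "G.inside_ok w g C"
      using CQ heavy_subset[OF h] by (intro IH) (auto intro: G.plane_graph_axioms)
    then have B2: "g * (real (card (iedges C - Q)) - real (card (iverts C - R)) + 1) \<le> 2 * sum w (iedges C - Q) + sum w C"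
      by (simp add: G.inside_ok_def Gi Gv)
    have c: "card (iedges C) = card Q + card (iedges C - Q)" "card (iverts C) = card R + card (iverts C - R)"
      using card_Diff_subset[OF fin(2) QI] card_Diff_subset[OF fin(1) Ri] card_mono[OF finI(1) QI] card_mono[OF finI(2) Ri]
      by auto
    have s: "sum w (iedges C) = sum w Q + sum w (iedges C - Q)"
      using sum.subset_diff[OF QI finI(1), of w] by simp
    have "g * (real (card (iedges C)) - real (card (iverts C)) + 1) =
      g * (real (card Q) - real (card R)) + g * (real (card (iedges C - Q)) - real (card (iverts C - R)) + 1)"
      unfolding c by (simp flip: distrib_left)
    then show ?thesis using B1 B2 s unfolding inside_ok_def by linarith
  qed
qed

text \<open>Weights are tested on leafless sets, to which cycles belong, because these can be
  explored edge by edge. The first alternative covers forests: for a tree the second would say that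
  \<open>g\<close> is at most twice the total weight, which may fail.\<close>

theorem (in plane_graph) euler_weighted:
  fixes w :: "'a set \<Rightarrow> real"
  assumes "V \<noteq> {}" "g \<ge> 0" "\<And>e. e \<in> E \<Longrightarrow> 0 \<le> w e" "\<And>C. C \<subseteq> E \<Longrightarrow> leafless C \<Longrightarrow> g \<le> sum w C"
  shows "card E + 1 \<le> card V \<or> g * (real (card E) - real (card V) + 2) \<le> 2 * sum w E"
proof (cases "\<exists>C W. cycle E C W")
  case True
  then obtain C W where C: "cycle E C W" by blast
  have h: "heavy w g E"
    unfolding heavy_def using assms(3) assms(4)[OF cycle_subset cycle_leafless] by auto
  have "g * (real (card E) - real (card V) + 2) \<le> 2 * sum w E"
    by (rule euler_from_inside[OF C h assms(2)]) (rule inside_bound[OF _ _ _ assms(2)])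
  then show ?thesis ..
next
  case False
  then show ?thesis using forest_or_cycle assms(1) by blast
qed

subsection \<open>Distance layers\<close>

lemma sum_eq_const: "(\<And>x. x \<in> A \<Longrightarrow> f x = c) \<Longrightarrow> sum f A = real (card A) * c"
  using sum.cong[of A A f "\<lambda>_. c"] by simp

context plane_graph
begin

text \<open>Connectedness is encoded by the number of edges, the form in which the tree enters
  Euler's inequality.\<close>

definition tree_on :: "'a set \<Rightarrow> 'a set set \<Rightarrow> bool" where
  "tree_on S T \<longleftrightarrow> S \<subseteq> V \<and> T \<subseteq> E \<and> \<Union>T \<subseteq> S \<and> card S = card T + 1 \<and> (\<forall>C\<subseteq>T. \<not> leafless C)"

lemma other_end:
  assumes "e \<in> E" "y \<in> e"
  obtains z where "e = {y, z}" "y \<noteq> z"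
proof -
  obtain a b where "e = {a, b}" "a \<noteq> b" using edge_card[OF assms(1)] by (meson card_2_iff)
  then show ?thesis using that[of a] that[of b] assms(2) by auto
qed

section \<open>Edge bounds around a contracted tree with one chosen link to each vertex of
  \<open>N\<close>\<close>

context
  fixes S N :: "'a set" and T :: "'a set set" and q :: "'a \<Rightarrow> 'a" and M :: "'a set set"
  assumes tree: "tree_on S T" and N: "N \<subseteq> V - S"
    and q: "\<And>v. v \<in> N \<Longrightarrow> q v \<in> S" "\<And>v. v \<in> N \<Longrightarrow> {v, q v} \<in> E"
  defines "M \<equiv> (\<lambda>v. {v, q v}) ` N"
begin

lemma T_facts: "S \<subseteq> V" "T \<subseteq> E" "e \<in> T \<Longrightarrow> e \<subseteq> S" "card S = card T + 1" "C \<subseteq> T \<Longrightarrow> \<not> leafless C"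
  using tree by (auto simp: tree_on_def)

lemma finite_sets: "finite S" "finite N" "finite T" "finite M"
proof -
  show "finite S" "finite T" using T_facts(1,2) finite_V finite_E finite_subset by blast+
  show "finite N" using N finite_V finite_subset by blast
  then show "finite M" by (simp add: M_def)
qed

lemma M_edge: "e \<in> M \<Longrightarrow> v \<in> e \<Longrightarrow> v \<notin> S \<Longrightarrow> v \<in> N \<and> e = {v, q v}"
  using q(1) by (auto simp: M_def)

lemma M_sub: "M \<subseteq> E" using q(2) by (auto simp: M_def)

lemma M_T: "T \<inter> M = {}"
  using T_facts(3) N by (fastforce simp: M_def)

lemma card_M: "card M = card N"
proof -
  have "inj_on (\<lambda>v. {v, q v}) N"
  proof (rule inj_onI)
    fix x y assume "x \<in> N" "y \<in> N" "{x, q x} = {y, q y}"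
    moreover have "x \<notin> S" "q y \<in> S" using calculation N q by auto
    ultimately show "x = y" by (metis doubleton_eq_iff)
  qed
  then show ?thesis by (simp add: M_def card_image)
qed

text \<open>Each link ends in a vertex of \<open>N\<close> that lies on no other edge of
  \<open>T \<union> M\<close>, so a leafless subset contains no link and would lie in
  \<open>T\<close>. This lets the contracted set absorb the next layer.\<close>

lemma tree_extend: "tree_on (S \<union> N) (T \<union> M)"
  unfolding tree_on_def
proof (intro conjI allI impI notI)
  show "S \<union> N \<subseteq> V" using T_facts(1) N by auto
  show "T \<union> M \<subseteq> E" using T_facts(2) M_sub by auto
  show "\<Union>(T \<union> M) \<subseteq> S \<union> N" using T_facts(3) q(1) by (auto simp: M_def)
  have "S \<inter> N = {}" using N by auto
  then show "card (S \<union> N) = card (T \<union> M) + 1"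
    using finite_sets M_T T_facts(4) card_M by (simp add: card_Un_disjoint)
next
  fix C assume C: "C \<subseteq> T \<union> M" "leafless C"
  have "e \<in> T" if eC: "e \<in> C" for e
  proof (rule ccontr)
    assume "e \<notin> T"
    then obtain v where v: "e = {v, q v}" "v \<in> N" using eC C(1) by (auto simp: M_def)
    then obtain f where f: "f \<in> C" "f \<noteq> e" "v \<in> f" using leaflessE[OF C(2) eC] by blast
    have "v \<notin> S" using v N by auto
    then have "f \<notin> T" using f T_facts(3) by auto
    then have "f \<in> M" using f C(1) by auto
    then have "f = e" using M_edge f(3) \<open>v \<notin> S\<close> v by metis
    then show False using f by simp
  qed
  then show False using T_facts(5) C(2) by (metis subsetI)
qed

text \<open>
  In both bounds below the tree edges get weight 0, so that every leafless set of edges must have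
  weight at least 3 outside \<open>T\<close>. In the second bound the links \<open>M\<close> get weight \<open>1 / 2\<close>: a cycle through
  the contracted set uses two links and, since the edges inside \<open>N\<close> are dropped, at least two more edges.
\<close>

lemma inner_edges_bound:
  assumes "card (V - S) \<ge> 2"
  shows "card N + card {e \<in> E. e \<subseteq> V - S} + 3 \<le> 3 * card (V - S)"
proof -
  define R where "R = V - S"
  define ER where "ER = {e \<in> E. e \<subseteq> R}"
  define E' where "E' = T \<union> M \<union> ER"
  define w where "w = (\<lambda>e. if e \<in> T then 0 else 1 :: real)"
  have EE: "E' \<subseteq> E" using T_facts(2) M_sub by (auto simp: E'_def ER_def)
  then have "plane_graph V E' pos crv" using edge_sub by (intro subgraph) auto
  then interpret G: plane_graph V E' pos crv .
  have d: "(T \<union> M) \<inter> ER = {}"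
  proof -
    have "v \<notin> e" if "e \<in> ER" "v \<in> S" for e v using that by (auto simp: ER_def R_def)
    moreover have "\<exists>v\<in>S. v \<in> e" if "e \<in> T \<union> M" for e
    proof (cases "e \<in> T")
      case True
      then have "e \<noteq> {}" "e \<subseteq> S" using T_facts edge_card by fastforce+
      then show ?thesis by auto
    qed (use that q(1) in \<open>auto simp: M_def\<close>)
    ultimately show ?thesis by blast
  qed
  have finE': "finite ER" using finite_E by (simp add: ER_def)
  have cE: "card E' = card T + card N + card ER"
    using d finE' finite_sets M_T card_M by (simp add: E'_def card_Un_disjoint)
  have cV: "card V = card S + card R"
    using T_facts(1) finite_V finite_sets by (simp add: R_def card_Diff_subset card_mono)
  have sT: "sum w T = 0" by (simp add: w_def)
  have "w e = 1" if "e \<in> M \<union> ER" for e using that M_T d by (auto simp: w_def)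
  then have "sum w M = card M" "sum w ER = card ER" using sum_eq_const[of _ w 1] by simp_all
  then have sE: "sum w E' = card N + card ER"
    using sT d finE' finite_sets M_T card_M by (simp add: E'_def sum.union_disjoint)
  have "card E' + 1 \<le> card V \<or> 3 * (real (card E') - real (card V) + 2) \<le> 2 * sum w E'"
  proof (rule G.euler_weighted)
    show "V \<noteq> {}" using assms by auto
    fix C assume C: "C \<subseteq> E'" "leafless C"
    have fC: "finite C" using C(1) finE' finite_sets finite_subset by (metis E'_def finite_UnI)
    have nT: "v \<notin> S \<Longrightarrow> v \<in> e \<Longrightarrow> e \<notin> T" for v e using T_facts(3) by auto
    have CE: "e \<in> E" if "e \<in> C" for e using that C(1) EE by auto
    obtain e where e: "e \<in> C" "e \<notin> T" using T_facts(5) C(2) by blast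
    then have "e \<in> M \<or> e \<in> ER" using C(1) by (auto simp: E'_def)
    then obtain v where v: "v \<in> e" "v \<notin> S"
    proof
      assume "e \<in> M"
      then show ?thesis using that N by (auto simp: M_def)
    next
      assume "e \<in> ER"
      then have "e \<noteq> {}" "e \<subseteq> R" using edge_card by (fastforce simp: ER_def)+
      then show ?thesis using that by (auto simp: R_def)
    qed
    obtain f where f: "f \<in> C" "f \<noteq> e" "v \<in> f" using leaflessE[OF C(2) e(1) v(1)] .
    \<comment> \<open>Both edges contain \<open>v\<close> outside \<open>S\<close>, so neither is in
      \<open>T\<close>; they cannot both be links, because \<open>v\<close> has only one.\<close>
    have "e \<in> ER \<or> f \<in> ER"
    proof (rule ccontr)
      assume "\<not> ?thesis"
      then have "e \<in> M" "f \<in> M" using e f C(1) nT[OF v(2)] by (auto simp: E'_def)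
      then show False using M_edge v f by metis
    qed
    then obtain h k where hk: "h \<in> C" "k \<in> C" "h \<noteq> k" "v \<in> h" "v \<in> k" "h \<in> ER" using e f v by metis
    then obtain y where y: "h = {v, y}" "v \<noteq> y" using other_end CE by metis
    have "y \<notin> S" using hk(6) y by (auto simp: ER_def R_def)
    \<comment> \<open>Both ends of \<open>h\<close> avoid \<open>S\<close>, so the next edges
      \<open>k\<close> and \<open>l\<close> at these ends have weight 1 as well, and they differ
      since the graph has no parallel edges.\<close>
    obtain l where l: "l \<in> C" "l \<noteq> h" "y \<in> l" using leaflessE[OF C(2) hk(1), of y] y by auto
    have "l \<noteq> k"
    proof
      assume "l = k"
      then have "y \<in> k" using l by simp
      obtain z where "k = {v, z}" using other_end CE hk by metis
      then show False using \<open>y \<in> k\<close> y hk by auto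
    qed
    have "h \<notin> T" "k \<notin> T" "l \<notin> T" using nT v hk l \<open>y \<notin> S\<close> by metis+
    then have "sum w {h, k, l} = 3" using hk l \<open>l \<noteq> k\<close> by (simp add: w_def)
    moreover have "sum w {h, k, l} \<le> sum w C" using hk l fC by (intro sum_mono2) (auto simp: w_def)
    ultimately show "3 \<le> sum w C" by simp
  qed (auto simp: w_def)
  then have "real (card N) + card ER + 3 \<le> 3 * real (card R)"
  proof
    \<comment> \<open>In the forest case \<open>N\<close> and \<open>ER\<close> have at most
      \<open>card R\<close> elements together, and \<open>card R \<ge> 2\<close> leaves room for the
      3.\<close>
    assume "card E' + 1 \<le> card V"
    then have "card N + card ER \<le> card R" using cE cV T_facts(4) by simp
    then show ?thesis using assms by (simp add: R_def)
  next
    assume "3 * (real (card E') - real (card V) + 2) \<le> 2 * sum w E'"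
    then show ?thesis using sE cE cV T_facts(4) by simp
  qed
  then show ?thesis unfolding ER_def R_def by linarith
qed

lemma outer_edges_bound:
  assumes U: "\<And>e. e \<in> E \<Longrightarrow> e \<inter> (V - S - N) \<noteq> {} \<Longrightarrow> e \<inter> S = {}"
    and "N \<noteq> {}" "V - S - N \<noteq> {}"
  shows "card {e \<in> E. e \<inter> (V - S - N) \<noteq> {}} + 3 \<le> 3 * card (V - S - N) + card N"
proof -
  define R where "R = V - S - N"
  define ER where "ER = {e \<in> E. e \<inter> R \<noteq> {}}"
  define E' where "E' = T \<union> M \<union> ER"
  define w where "w = (\<lambda>e. if e \<in> T then 0 else if e \<inter> R \<noteq> {} then 1 else 1 / 2 :: real)"
  have w0: "0 \<le> w e" for e by (simp add: w_def)
  have EE: "E' \<subseteq> E" using T_facts(2) M_sub by (auto simp: E'_def ER_def)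
  then have "plane_graph V E' pos crv" using edge_sub by (intro subgraph) auto
  then interpret G: plane_graph V E' pos crv .
  have TR: "e \<inter> R = {}" if "e \<in> T" for e using that T_facts(3) by (auto simp: R_def)
  have MR: "e \<inter> R = {}" if "e \<in> M" for e using that q(1) by (auto simp: R_def M_def)
  have d: "(T \<union> M) \<inter> ER = {}" using TR MR by (auto simp: ER_def)
  have finE': "finite ER" using finite_E by (simp add: ER_def)
  have cE: "card E' = card T + card N + card ER"
    using d finE' finite_sets M_T card_M by (simp add: E'_def card_Un_disjoint)
  have cV: "card V = card S + card N + card R"
  proof -
    have "V = S \<union> N \<union> R" "S \<inter> N = {}" "(S \<union> N) \<inter> R = {}" using T_facts(1) N by (auto simp: R_def)
    then show ?thesis using finite_sets finite_V by (metis card_Un_disjoint finite_Un)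
  qed
  have sT: "sum w T = 0" by (simp add: w_def)
  have "w e = 1 / 2" if "e \<in> M" for e using that M_T MR by (auto simp: w_def)
  then have "sum w M = card M / 2" using sum_eq_const[of M w "1 / 2"] by simp
  moreover have "w e = 1" if "e \<in> ER" for e using that d by (auto simp: w_def ER_def)
  then have "sum w ER = card ER" using sum_eq_const[of ER w 1] by simp
  ultimately have sE: "sum w E' = card N / 2 + card ER"
    using sT d finE' finite_sets M_T card_M by (simp add: E'_def sum.union_disjoint)
  have pos: "card N > 0" "card R > 0"
    using assms finite_sets finite_V by (auto simp: R_def card_gt_0_iff)
  have "card E' + 1 \<le> card V \<or> 3 * (real (card E') - real (card V) + 2) \<le> 2 * sum w E'"
  proof (rule G.euler_weighted)
    show "V \<noteq> {}" using assms by auto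
    fix C assume C: "C \<subseteq> E'" "leafless C"
    have fC: "finite C" using C(1) finE' finite_sets finite_subset by (metis E'_def finite_UnI)
    have nT: "v \<notin> S \<Longrightarrow> v \<in> e \<Longrightarrow> e \<notin> T" for v e using T_facts(3) by auto
    have CE: "e \<in> E" if "e \<in> C" for e using that C(1) EE by auto
    have ERS: "e \<inter> S = {}" if "e \<in> ER" for e using U that by (auto simp: ER_def R_def)
    have "\<exists>e\<in>C. e \<in> ER"
    proof -
      obtain e where e: "e \<in> C" "e \<notin> T" using T_facts(5) C(2) by blast
      show ?thesis
      proof (cases "e \<in> M")
        case True
        then obtain v where v: "v \<in> N" "e = {v, q v}" by (auto simp: M_def)
        then obtain f where f: "f \<in> C" "f \<noteq> e" "v \<in> f" using leaflessE[OF C(2) e(1)] by blast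
        have "v \<notin> S" using v N by auto
        then have "f \<notin> T" "f \<notin> M" using nT f M_edge[of f v] v by auto
        then show ?thesis using f C(1) by (auto simp: E'_def)
      qed (use e C(1) in \<open>auto simp: E'_def\<close>)
    qed
    \<comment> \<open>Start from a vertex \<open>y\<close> of \<open>R\<close> on an edge of
      \<open>C\<close>: its edges \<open>e1\<close>, \<open>e2\<close> have weight 1, and their
      other ends avoid \<open>S\<close>. The continuations \<open>f1\<close>, \<open>f2\<close> are
      not tree edges and weigh at least \<open>1 / 2\<close> each.\<close>
    then obtain e1 y where e1: "e1 \<in> C" "e1 \<in> ER" "y \<in> e1" "y \<in> R" by (auto simp: ER_def)
    obtain e2 where e2: "e2 \<in> C" "e2 \<noteq> e1" "y \<in> e2" using leaflessE[OF C(2) e1(1,3)] .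
    have e2R: "e2 \<in> ER" using e2 e1 CE by (auto simp: ER_def)
    obtain z1 where z1: "e1 = {y, z1}" "y \<noteq> z1" using other_end CE e1 by metis
    obtain z2 where z2: "e2 = {y, z2}" "y \<noteq> z2" using other_end CE e2 by metis
    have zS: "z1 \<notin> S" "z2 \<notin> S" using ERS[OF e1(2)] ERS[OF e2R] z1 z2 by auto
    have zz: "z1 \<noteq> z2" using e2 z1 z2 by auto
    obtain f1 where f1: "f1 \<in> C" "f1 \<noteq> e1" "z1 \<in> f1" using leaflessE[OF C(2) e1(1), of z1] z1 by auto
    obtain f2 where f2: "f2 \<in> C" "f2 \<noteq> e2" "z2 \<in> f2" using leaflessE[OF C(2) e2(1), of z2] z2 by auto
    have ne: "f1 \<noteq> e2" "f2 \<noteq> e1" using f1 f2 z1 z2 zz by auto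
    have w1: "w e1 = 1" "w e2 = 1" using d e1(2) e2R by (auto simp: w_def ER_def)
    have wf: "w f1 \<ge> 1 / 2" "w f2 \<ge> 1 / 2" using nT[OF zS(1) f1(3)] nT[OF zS(2) f2(3)] by (auto simp: w_def)
    show "3 \<le> sum w C"
    proof (cases "f1 = f2")
      case True
      \<comment> \<open>A common continuation joins \<open>z1\<close> and \<open>z2\<close>, both
        outside \<open>S\<close>, whereas a link has an end in \<open>S\<close>. So it weighs 1 and
        completes a triangle of weight 3.\<close>
      have "f1 \<notin> M"
      proof
        assume "f1 \<in> M"
        then have "f1 = {z1, q z1}" "z1 \<in> N" using M_edge[of f1 z1] f1(3) zS by auto
        then have "z2 \<in> S" using f2(3) True zz q(1) by auto
        then show False using zS by simp
      qed
      moreover have "f1 \<notin> T" using nT zS f1 by metis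
      ultimately have "f1 \<in> ER" using f1 C(1) by (auto simp: E'_def)
      then have "w f1 = 1" using d by (auto simp: w_def ER_def)
      then have "sum w {e1, e2, f1} = 3" using w1 e2(2) f1(2) ne(1) by simp
      moreover have "sum w {e1, e2, f1} \<le> sum w C" using e1 e2 f1 fC w0 by (intro sum_mono2) auto
      ultimately show ?thesis by simp
    next
      case False
      then have "sum w {e1, e2, f1, f2} \<ge> 3" using w1 wf e2(2) f1(2) f2(2) ne by simp
      moreover have "sum w {e1, e2, f1, f2} \<le> sum w C" using e1 e2 f1 f2 fC w0 by (intro sum_mono2) auto
      ultimately show ?thesis by simp
    qed
  qed (auto simp: w0)
  then have "real (card ER) + 3 \<le> 3 * real (card R) + card N"
  proof
    \<comment> \<open>In the forest case \<open>card ER\<close> is at most \<open>card R\<close>,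
      and as both \<open>N\<close> and \<open>R\<close> are nonempty, the 3 is covered.\<close>
    assume "card E' + 1 \<le> card V"
    then have "card ER \<le> card R" using cE cV T_facts(4) by simp
    then show ?thesis using pos by simp
  next
    assume "3 * (real (card E') - real (card V) + 2) \<le> 2 * sum w E'"
    then show ?thesis using sE cE cV T_facts(4) by simp
  qed
  then show ?thesis unfolding ER_def R_def by linarith
qed

end

text \<open>Double counting: an edge contributes the number of its ends in \<open>U\<close>, namely
  1 for meeting \<open>U\<close> and another 1 for lying within \<open>U\<close>.\<close>

lemma degree_sum:
  assumes "U \<subseteq> V"
  shows "(\<Sum>v\<in>U. vertex_degree E v) = card {e \<in> E. e \<inter> U \<noteq> {}} + card {e \<in> E. e \<subseteq> U}"
proof -
  have finU: "finite U" using assms finite_V finite_subset by metis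
  have "(\<Sum>v\<in>U. vertex_degree E v) = (\<Sum>v\<in>U. \<Sum>e\<in>E. if v \<in> e then 1 else 0)"
    using finite_E by (simp add: vertex_degree_def sum.If_cases Int_def)
  also have "\<dots> = (\<Sum>e\<in>E. \<Sum>v\<in>U. if v \<in> e then 1 else 0)" by (rule sum.swap)
  also have "\<dots> = (\<Sum>e\<in>E. (if e \<inter> U \<noteq> {} then 1 else 0) + (if e \<subseteq> U then 1 else 0))"
  proof (rule sum.cong)
    fix e assume "e \<in> E"
    then obtain a b where "e = {a, b}" "a \<noteq> b" using edge_card by (meson card_2_iff)
    moreover have "(\<Sum>v\<in>U. if v \<in> e then 1 else 0) = card (U \<inter> e)"
      using finU by (simp add: sum.If_cases Int_def)
    ultimately show "(\<Sum>v\<in>U. if v \<in> e then 1 else 0) = (if e \<inter> U \<noteq> {} then 1 else 0) + (if e \<subseteq> U then 1 else 0 :: nat)"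
      by (auto simp: Int_insert_right)
  qed simp
  also have "\<dots> = card {e \<in> E. e \<inter> U \<noteq> {}} + card {e \<in> E. e \<subseteq> U}"
    using finite_E by (simp add: sum.distrib sum.If_cases Int_def)
  finally show ?thesis .
qed

text \<open>Induction over the layers: the next layer \<open>N'\<close> is smaller than
  \<open>N\<close>, and the bound is twice the sum \<open>(n - 1) + ... + 1 + 1\<close> with
  \<open>n = card N\<close>. The final 2 covers the end, when at most one vertex remains. The
  hypothesis \<open>deg\<close> speaks of all subsets so that it passes on to later layers.\<close>

lemma layer_bound:
  assumes "tree_on S T" "N = {v \<in> V - S. \<exists>s\<in>S. {v, s} \<in> E}" "N \<noteq> {}" "U = V - S - N"
    and deg: "\<And>U'. U' \<subseteq> U \<Longrightarrow> (\<Sum>v\<in>U'. 6 - int (vertex_degree E v)) \<le> 5"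
  shows "2 * card U \<le> card N * (card N - 1) + 2"
  using assms
proof (induction "card U" arbitrary: S T N U rule: less_induct)
  case less
  note deg = less.prems(5)
  show ?case
  proof (cases "card U \<ge> 2")
    case U2: True
    have N: "N \<subseteq> V - S" and U: "U = V - (S \<union> N)" using less.prems by auto
    have "\<forall>v\<in>N. \<exists>s. s \<in> S \<and> {v, s} \<in> E" using less.prems(2) by auto
    then obtain q where q: "\<And>v. v \<in> N \<Longrightarrow> q v \<in> S" "\<And>v. v \<in> N \<Longrightarrow> {v, q v} \<in> E" by metis
    define N' where "N' = {v \<in> V - (S \<union> N). \<exists>s\<in>S \<union> N. {v, s} \<in> E}"
    have finN: "finite N" "finite N'" "finite U" using N finite_V finite_subset less.prems(4) by (auto simp: N'_def)
    \<comment> \<open>\<open>N\<close> contains every neighbour of \<open>S\<close> outside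
      \<open>S\<close>, so vertices beyond \<open>N\<close> have none in \<open>S\<close>.\<close>
    have US: "e \<inter> S = {}" if eE: "e \<in> E" and eU: "e \<inter> U \<noteq> {}" for e
    proof (rule ccontr)
      assume "e \<inter> S \<noteq> {}"
      then obtain v s where "v \<in> U" "v \<in> e" "s \<in> S" "s \<in> e" using eU by blast
      moreover from this have "v \<noteq> s" using less.prems(4) by auto
      ultimately have "{v, s} \<in> E" using other_end eE by (metis insertE singletonD)
      then have "v \<in> N" using \<open>v \<in> U\<close> \<open>s \<in> S\<close> less.prems(2,4) by auto
      then show False using \<open>v \<in> U\<close> less.prems(4) by auto
    qed
    have "\<forall>v\<in>N'. \<exists>s. s \<in> S \<union> N \<and> {v, s} \<in> E" by (auto simp: N'_def)
    then obtain q' where q': "\<And>v. v \<in> N' \<Longrightarrow> q' v \<in> S \<union> N" "\<And>v. v \<in> N' \<Longrightarrow> {v, q' v} \<in> E" by metis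
    note T' = tree_extend[OF less.prems(1) N q]
    define a b where "a = card {e \<in> E. e \<inter> U \<noteq> {}}" and "b = card {e \<in> E. e \<subseteq> U}"
    have "U \<noteq> {}" using U2 by auto
    then have B: "a + 3 \<le> 3 * card U + card N"
      using outer_edges_bound[OF less.prems(1) N q] US less.prems(3,4) unfolding a_def by simp
    have A: "card N' + b + 3 \<le> 3 * card U"
    proof -
      have "N' \<subseteq> V - (S \<union> N)" by (auto simp: N'_def)
      from inner_edges_bound[OF T' this q'] U2 show ?thesis unfolding b_def U by simp
    qed
    have UV: "U \<subseteq> V" using less.prems(4) by auto
    have "6 * int (card U) - int (\<Sum>v\<in>U. vertex_degree E v) \<le> 5"
      using deg[of U] by (simp add: sum_subtractf)
    then have D: "6 * card U \<le> 5 + a + b"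
      using degree_sum[OF UV] unfolding a_def b_def by linarith
    \<comment> \<open>Adding \<open>A\<close> and \<open>B\<close> gives
      \<open>a + b + card N' + 6 \<le> 6 * card U + card N\<close>, and \<open>D\<close> bounds
      \<open>6 * card U\<close> by \<open>5 + a + b\<close>.\<close>
    have le: "card N' + 1 \<le> card N" using A B D by linarith
    \<comment> \<open>Without a next layer all edges at \<open>U\<close> lie within
      \<open>U\<close>, so \<open>a \<le> b\<close>. By \<open>A\<close>, then
      \<open>a + b \<le> 6 * card U - 6\<close>, against \<open>D\<close>.\<close>
    have ne: "N' \<noteq> {}"
    proof
      assume "N' = {}"
      have "e \<subseteq> U" if eE: "e \<in> E" and eU: "e \<inter> U \<noteq> {}" for e
      proof -
        obtain v where v: "v \<in> e" "v \<in> U" using eU by auto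
        then obtain s where s: "e = {v, s}" using other_end eE by metis
        then have "s \<in> V" "s \<notin> S \<union> N" using edge_sub eE v(2) \<open>N' = {}\<close> U by (auto simp: N'_def)
        then show ?thesis using s v U by auto
      qed
      then have "{e \<in> E. e \<inter> U \<noteq> {}} \<subseteq> {e \<in> E. e \<subseteq> U}" by auto
      then have "a \<le> b" unfolding a_def b_def using finite_E by (intro card_mono) auto
      then show False using A D by linarith
    qed
    have N'U: "N' \<subseteq> U" by (auto simp: N'_def U)
    have cU: "card U = card N' + card (U - N')"
      using card_Diff_subset[OF finN(2) N'U] card_mono[OF finN(3) N'U] by simp
    have "card N' > 0" using ne finN by (simp add: card_gt_0_iff)
    then have "2 * card (U - N') \<le> card N' * (card N' - 1) + 2"
      using cU ne deg by (intro less.hyps[OF _ T' N'_def]) (auto simp: U N'_def)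
    then have "2 * card U \<le> card N' * (card N' - 1) + 2 * card N' + 2" using cU by simp
    also have "card N' * (card N' - 1) + 2 * card N' = card N' * (card N' + 1)"
      using \<open>card N' > 0\<close> by (cases "card N'") auto
    also have "\<dots> \<le> (card N - 1) * card N" using le by (intro mult_mono) auto
    finally show ?thesis by (simp add: mult.commute)
  qed auto
qed

end

subsection \<open>The apex outside the disk\<close>

text \<open>The inverse of the arc would map a ball injectively and continuously into an interval.
  Deleting a point keeps the ball connected, but deleting a value \<open>t\<close> strictly between
  two others disconnects its image.\<close>

lemma interior_arc_image:
  fixes \<gamma> :: "real \<Rightarrow> complex"
  assumes "arc \<gamma>"
  shows "interior (path_image \<gamma>) = {}"
proof (rule ccontr)
  assume "interior (path_image \<gamma>) \<noteq> {}"
  then obtain x r where B: "r > 0" "ball x r \<subseteq> path_image \<gamma>" by (meson ex_in_conv mem_interior)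
  have c: "continuous_on {0..1} \<gamma>" and i: "inj_on \<gamma> {0..1}" using assms by (auto simp: arc_def path_def)
  then obtain g where g: "homeomorphism {0..1} (path_image \<gamma>) \<gamma> g"
    unfolding path_image_def by (metis homeomorphism_compact compact_Icc)
  then have g': "continuous_on (path_image \<gamma>) g" "\<And>y. y \<in> path_image \<gamma> \<Longrightarrow> \<gamma> (g y) = y"
    by (auto simp: homeomorphism_def)
  then have gB: "continuous_on (ball x r) g" "inj_on g (ball x r)"
    using B(2) continuous_on_subset inj_on_inverseI[of "ball x r" \<gamma> g] by (blast, blast)
  define y where "y = x + of_real (r / 2)"
  have y: "y \<in> ball x r" "x \<in> ball x r" "x \<noteq> y" using B(1) by (auto simp: y_def dist_norm)
  then have gxy: "g x \<noteq> g y" using gB(2) by (metis inj_onD)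
  have conn: "connected (g ` ball x r)" using gB(1) by (intro connected_continuous_image) auto
  define t where "t = (g x + g y) / 2"
  have t: "min (g x) (g y) < t" "t < max (g x) (g y)" using gxy by (auto simp: t_def min_def max_def)
  then have "t \<in> g ` ball x r"
    using connectedD_interval[OF conn, of "min (g x) (g y)" "max (g x) (g y)" t] y
    by (auto simp: min_def max_def split: if_splits)
  then obtain z where z: "z \<in> ball x r" "g z = t" by auto
  have "connected (g ` (ball x r - {z}))"
  proof (rule connected_continuous_image)
    show "continuous_on (ball x r - {z}) g" using gB(1) continuous_on_subset by blast
    show "connected (ball x r - {z})" by (intro connected_open_delete) auto
  qed
  moreover have "x \<noteq> z" "y \<noteq> z" using t z by (auto simp: min_def max_def split: if_splits)
  then have "g x \<in> g ` (ball x r - {z})" "g y \<in> g ` (ball x r - {z})" using y by auto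
  ultimately have "t \<in> g ` (ball x r - {z})"
    using connectedD_interval[of "g ` (ball x r - {z})" "min (g x) (g y)" "max (g x) (g y)" t] t
    by (auto simp: min_def max_def split: if_splits)
  then show False using z gB(2) by (auto dest: inj_onD)
qed

lemma interior_finite_Union_empty:
  fixes F :: "'a::topological_space set set"
  assumes "finite F" "\<And>S. S \<in> F \<Longrightarrow> closed S \<and> interior S = {}"
  shows "interior (\<Union>F) = {}"
  using assms by (induction F rule: finite_induct) (simp_all add: interior_closed_Un_empty_interior)

text \<open>Arcs and points are closed with empty interior, and so is a finite union of them. The
  point found serves as the centre of the inversion that makes room for the apex.\<close>

lemma (in plane_graph) ball_not_covered:
  assumes "r > 0"
  obtains p where "p \<in> ball c r" "p \<notin> img E" "p \<notin> pos ` V"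
proof -
  let ?F = "(\<lambda>e. path_image (crv e)) ` E \<union> (\<lambda>x. {pos x}) ` V"
  have "interior (\<Union>?F) = {}"
    using finite_E finite_V arc_crv interior_arc_image closed_arc_image
    by (intro interior_finite_Union_empty) auto
  moreover have "\<Union>?F = img E \<union> pos ` V" by (auto simp: img_def)
  ultimately have "interior (img E \<union> pos ` V) = {}" by simp
  then have "\<not> ball c r \<subseteq> img E \<union> pos ` V"
    using assms interior_maximal[OF _ open_ball, of c r] by (metis ball_eq_empty not_le subset_empty)
  then show ?thesis using that by blast
qed

text \<open>Otherwise \<open>z\<close> would be a proper convex combination of the interior point
  \<open>p\<close> and a point of the disk, hence in the open disk.\<close>

lemma ray_leaves_cball:
  fixes c p z :: complex
  assumes "p \<in> ball c r" "z \<in> sphere c r" "s > 1"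
  shows "p + s *\<^sub>R (z - p) \<notin> cball c r"
proof
  assume y: "p + s *\<^sub>R (z - p) \<in> cball c r"
  have "z - c = (1 - 1 / s) *\<^sub>R (p - c) + (1 / s) *\<^sub>R (p + s *\<^sub>R (z - p) - c)"
    using assms(3) by (simp add: algebra_simps)
  then have "norm (z - c) \<le> norm ((1 - 1 / s) *\<^sub>R (p - c)) + norm ((1 / s) *\<^sub>R (p + s *\<^sub>R (z - p) - c))"
    using norm_triangle_ineq by metis
  also have "\<dots> = (1 - 1 / s) * norm (p - c) + (1 / s) * norm (p + s *\<^sub>R (z - p) - c)"
    using assms(3) by simp
  also have "\<dots> < (1 - 1 / s) * r + (1 / s) * r"
    using assms(1,3) y by (intro add_less_le_mono mult_strict_left_mono mult_left_mono) (auto simp: dist_norm norm_minus_commute)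
  finally show False using assms(2) by (simp add: dist_norm norm_minus_commute algebra_simps)
qed

text \<open>Undoing the inversion, the segment from 0 to the image of \<open>z\<close> becomes the
  part of the ray from \<open>p\<close> through \<open>z\<close> that starts at \<open>z\<close> and
  goes to infinity; the factor is \<open>1 / t \<ge> 1\<close>. This part meets the disk only in
  \<open>z\<close>.\<close>

lemma spoke_meets:
  fixes c p z w :: complex
  assumes "p \<in> ball c r" "z \<in> sphere c r" "w \<in> cball c r" "w \<noteq> p" "0 < t" "t \<le> 1"
    and eq: "t *\<^sub>R (1 / (z - p)) = 1 / (w - p)"
  shows "w = z"
proof -
  have zp: "z \<noteq> p" using assms(1,2) by auto
  have "w - p = (1 / t) *\<^sub>R (z - p)" using eq zp assms(4,5) by (simp add: scaleR_conv_of_real field_simps)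
  then have w: "w = p + (1 / t) *\<^sub>R (z - p)" by (simp add: algebra_simps)
  have "\<not> 1 / t > 1" using ray_leaves_cball[OF assms(1,2), of "1 / t"] w assms(3) by auto
  then have "t = 1" using assms(5,6) by (simp add: field_simps)
  then show ?thesis using w by simp
qed

text \<open>
  The apex is placed at infinity and joined to \<open>X\<close> by rays from a point \<open>p\<close> of the disk; the inversion
  at \<open>p\<close> turns these rays into segments from 0.
\<close>

lemma (in plane_graph) add_apex:
  assumes "img E \<subseteq> cball c r" "pos ` V \<subseteq> cball c r" "r > 0" "X \<subseteq> V" "pos ` X \<subseteq> sphere c r"
  obtains pos' crv' where
    "plane_graph (insert None (Some ` V)) ((`) Some ` E \<union> (\<lambda>x. {None, Some x}) ` X) pos' crv'"
proof -
  obtain p where p: "p \<in> ball c r" "p \<notin> img E" "p \<notin> pos ` V" using ball_not_covered[OF assms(3)] .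
  define f where "f = (\<lambda>z. 1 / (z - p))"
  define A where "A = f ` (cball c r - {p})"
  have "plane_graph V E (f \<circ> pos) (\<lambda>e. f \<circ> crv e)"
    using assms(1,2) p
    by (intro plane_graph_image[of "cball c r - {p}"]) (auto simp: f_def inj_on_def intro!: continuous_intros)
  then interpret G: plane_graph V E "f \<circ> pos" "\<lambda>e. f \<circ> crv e" .
  have crvA: "path_image (f \<circ> crv e) \<subseteq> A" if "e \<in> E" for e
    using that assms(1) p(2) by (auto simp: A_def path_image_compose img_def)
  have posA: "f (pos x) \<in> A" if "x \<in> V" for x
    using that assms(2) p(3) by (auto simp: A_def)
  have A0: "0 \<notin> A" by (auto simp: A_def f_def)
  have pos0: "f (pos x) \<noteq> 0" if "x \<in> V" for x using posA[OF that] A0 by metis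
  have Xp: "pos x \<noteq> p" "pos x \<in> sphere c r" "pos x \<in> cball c r" if "x \<in> X" for x
    using that assms(4,5) p(3) by auto
  have seg_iff: "y \<in> path_image (linepath 0 (f (pos x))) \<longleftrightarrow> (\<exists>t. 0 \<le> t \<and> t \<le> 1 \<and> y = t *\<^sub>R f (pos x))" for x y
    by (auto simp: in_segment)
  have segA: "path_image (linepath 0 (f (pos x))) \<inter> A = {f (pos x)}" if x: "x \<in> X" for x
  proof
    show "path_image (linepath 0 (f (pos x))) \<inter> A \<subseteq> {f (pos x)}"
    proof
      fix y assume y: "y \<in> path_image (linepath 0 (f (pos x))) \<inter> A"
      then obtain t where t: "0 \<le> t" "t \<le> 1" "y = t *\<^sub>R f (pos x)" using seg_iff by auto
      obtain w where w: "w \<in> cball c r" "w \<noteq> p" "y = f w" using y unfolding A_def by blast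
      have "t \<noteq> 0" using t(3) y A0 by auto
      then have "w = pos x" using spoke_meets[OF p(1) Xp(2)[OF x] w(1,2), of t] t w(3) by (simp add: f_def)
      then show "y \<in> {f (pos x)}" using w by simp
    qed
    show "{f (pos x)} \<subseteq> path_image (linepath 0 (f (pos x))) \<inter> A"
      using posA x assms(4) by auto
  qed
  have segseg: "path_image (linepath 0 (f (pos x))) \<inter> path_image (linepath 0 (f (pos x'))) = {0}"
    if x: "x \<in> X" "x' \<in> X" "x \<noteq> x'" for x x'
  proof
    have ne: "pos x \<noteq> pos x'" using x assms(4) inj_pos by (metis inj_onD subsetD)
    \<comment> \<open>Dividing by the larger parameter \<open>s\<close> puts the tip of the spoke of
      \<open>x'\<close> on the spoke of \<open>x\<close>. Since the tip comes from a point of the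
      disk, the two tips agree.\<close>
    have one: False if "x \<in> X" "x' \<in> X" "pos x \<noteq> pos x'" "0 < t" "t \<le> s" "s *\<^sub>R f (pos x') = t *\<^sub>R f (pos x)"
      for x x' s t
    proof -
      have "(t / s) *\<^sub>R f (pos x) = (1 / s) *\<^sub>R (t *\<^sub>R f (pos x))" by simp
      also have "\<dots> = f (pos x')" using that(4-5) by (simp flip: that(6))
      finally have "(t / s) *\<^sub>R (1 / (pos x - p)) = 1 / (pos x' - p)" by (simp add: f_def)
      then have "pos x' = pos x"
        using spoke_meets[OF p(1) Xp(2)[OF that(1)] Xp(3)[OF that(2)] Xp(1)[OF that(2)], of "t / s"] that(4,5) by simp
      then show False using that(3) by simp
    qed
    show "path_image (linepath 0 (f (pos x))) \<inter> path_image (linepath 0 (f (pos x'))) \<subseteq> {0}"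
    proof
      fix y assume y: "y \<in> path_image (linepath 0 (f (pos x))) \<inter> path_image (linepath 0 (f (pos x')))"
      obtain t where t: "0 \<le> t" "t \<le> 1" "y = t *\<^sub>R f (pos x)" using y seg_iff by blast
      obtain s where s: "0 \<le> s" "s \<le> 1" "y = s *\<^sub>R f (pos x')" using y seg_iff by blast
      show "y \<in> {0}"
      proof (rule ccontr)
        assume "y \<notin> {0}"
        then have "t > 0" "s > 0" using t s by (auto simp: less_le)
        then show False
          using one[OF x(1,2) ne, of t s] one[OF x(2,1) ne[symmetric], of s t] t s by (cases "t \<le> s") auto
      qed
    qed
  qed auto
  define pos' where "pos' = case_option 0 (f \<circ> pos)"
  \<comment> \<open>An edge containing \<open>None\<close> has the form
    \<open>{None, Some x}\<close>; \<open>the_elem\<close> recovers \<open>x\<close>, and the edge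
    becomes the segment from the apex at 0.\<close>
  define crv' where "crv' = (\<lambda>e. if None \<in> e then linepath 0 (f (pos (the_elem (the ` (e - {None}))))) else f \<circ> crv (the ` e))"
  define E1 E2 where "E1 = (`) Some ` E" and "E2 = (\<lambda>x. {None, Some x}) ` X"
  let ?V = "insert None (Some ` V)"
  have the_Some: "the ` Some ` e = e" for e :: "'a set" by (simp add: image_comp)
  have crv1: "crv' (Some ` e) = f \<circ> crv e" for e by (auto simp: crv'_def the_Some)
  have crv2: "crv' {None, Some x} = linepath 0 (f (pos x))" for x
    by (simp add: crv'_def insert_Diff_if)
  have pos1: "pos' ` Some ` S = (f \<circ> pos) ` S" for S by (simp add: pos'_def image_comp comp_def)
  have pos2: "pos' None = 0" "pos' (Some x) = f (pos x)" for x by (simp_all add: pos'_def)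
  have xpos: "f (pos x) \<in> path_image (f \<circ> crv e) \<longleftrightarrow> x \<in> e" if "e \<in> E" "x \<in> V" for e x
    using G.pos_img[of x "{e}"] G.pos_in_crv[of e x] that by (auto simp: G.img_def)
  have posV: "pos' ` ?V = insert 0 ((f \<circ> pos) ` V)" by (simp add: pos1 pos2)
  have "plane_graph ?V (E1 \<union> E2) pos' crv'"
  proof
    show "simple_graph ?V (E1 \<union> E2)"
      unfolding simple_graph_def
    proof (intro conjI ballI)
      show "finite ?V" using finite_V by simp
      fix e assume "e \<in> E1 \<union> E2"
      then consider e0 where "e0 \<in> E" "e = Some ` e0" | x where "x \<in> X" "e = {None, Some x}"
        by (auto simp: E1_def E2_def)
      then have "e \<subseteq> ?V \<and> card e = 2"
      proof cases
        case 1
        then show ?thesis using edge_sub[of e0] edge_card[of e0] by (auto simp: card_image)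
      qed (use assms(4) in auto)
      then show "e \<subseteq> ?V" "card e = 2" by auto
    qed
    have "inj_on pos' ?V"
    proof -
      have "inj_on pos' (Some ` V)" using G.inj_pos by (auto simp: inj_on_def pos'_def)
      moreover have "0 \<notin> pos' ` Some ` V" using pos0 unfolding pos1 by force
      ultimately show ?thesis by (simp add: pos2)
    qed
    moreover have "arc (crv' e) \<and> {pathstart (crv' e), pathfinish (crv' e)} = pos' ` e \<and>
      path_image (crv' e) \<inter> pos' ` ?V = pos' ` e" if "e \<in> E1 \<union> E2" for e
      using that
    proof
      assume "e \<in> E1"
      then obtain e0 where e0: "e0 \<in> E" "e = Some ` e0" by (auto simp: E1_def)
      have "0 \<notin> path_image (f \<circ> crv e0)" using crvA[OF e0(1)] A0 by auto
      then have "path_image (crv' e) \<inter> pos' ` ?V = pos' ` e"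
        using G.crv_pos[OF e0(1)] by (simp only: posV e0(2) crv1 pos1) auto
      then show ?thesis using G.arc_crv[OF e0(1)] G.ends_crv[OF e0(1)] by (simp add: e0(2) crv1 pos1)
    next
      assume "e \<in> E2"
      then obtain x where x: "x \<in> X" "e = {None, Some x}" by (auto simp: E2_def)
      have xV: "x \<in> V" using x assms(4) by auto
      have ne: "f (pos x) \<noteq> 0" using pos0[OF xV] .
      have seg: "path_image (linepath 0 (f (pos x))) \<inter> insert 0 ((f \<circ> pos) ` V) = {0, f (pos x)}"
      proof -
        have "(f \<circ> pos) ` V \<subseteq> A" using posA by auto
        then have "path_image (linepath 0 (f (pos x))) \<inter> (f \<circ> pos) ` V \<subseteq> {f (pos x)}" using segA[OF x(1)] by blast
        then show ?thesis using xV by auto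
      qed
      have e: "crv' e = linepath 0 (f (pos x))" "pos' ` e = {0, f (pos x)}" by (simp_all add: x(2) crv2 pos2)
      show ?thesis unfolding e posV using seg ne by (simp add: arc_linepath)
    qed
    moreover have "path_image (crv' e) \<inter> path_image (crv' e') = pos' ` (e \<inter> e')"
      if "e \<in> E1 \<union> E2" "e' \<in> E1 \<union> E2" "e \<noteq> e'" for e e'
    proof -
      \<comment> \<open>Old edges are drawn in \<open>A\<close>, which a spoke meets only at its
        tip.\<close>
      have mixed: "path_image (f \<circ> crv e0) \<inter> path_image (linepath 0 (f (pos x))) = pos' ` (Some ` e0 \<inter> {None, Some x})"
        if "e0 \<in> E" "x \<in> X" for e0 x
      proof -
        have "path_image (f \<circ> crv e0) \<inter> path_image (linepath 0 (f (pos x))) = path_image (f \<circ> crv e0) \<inter> {f (pos x)}"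
          using crvA[OF that(1)] unfolding segA[OF that(2), symmetric] by auto
        also have "\<dots> = (if x \<in> e0 then {f (pos x)} else {})"
          using xpos[OF that(1)] that(2) assms(4) by auto
        also have "\<dots> = pos' ` (Some ` e0 \<inter> {None, Some x})"
          by (auto simp: pos2 Int_insert_right)
        finally show ?thesis .
      qed
      have "(\<exists>e0\<in>E. g = Some ` e0) \<or> (\<exists>x\<in>X. g = {None, Some x})" if "g \<in> E1 \<union> E2" for g
        using that unfolding E1_def E2_def by blast
      from this[OF that(1)] this[OF that(2)] consider e0 e1 where "e0 \<in> E" "e1 \<in> E" "e = Some ` e0" "e' = Some ` e1"
        | e0 x where "e0 \<in> E" "x \<in> X" "e = Some ` e0" "e' = {None, Some x}"
        | e0 x where "e0 \<in> E" "x \<in> X" "e' = Some ` e0" "e = {None, Some x}"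
        | x y where "x \<in> X" "y \<in> X" "e = {None, Some x}" "e' = {None, Some y}"
        by blast
      then show ?thesis
      proof cases
        case 1
        then have ne: "e0 \<noteq> e1" using that(3) by auto
        have "Some ` e0 \<inter> Some ` e1 = Some ` (e0 \<inter> e1)" by auto
        then show ?thesis using G.crv_crv[OF 1(1,2) ne] unfolding 1(3,4) crv1 by (simp only: pos1)
      next
        case 2
        then show ?thesis using mixed by (simp add: crv1 crv2)
      next
        case 3
        then show ?thesis using mixed[OF 3(1,2)] by (simp add: crv1 crv2 Int_commute)
      next
        case 4
        then have "x \<noteq> y" using that(3) by auto
        then have "e \<inter> e' = {None}" using 4 by auto
        then show ?thesis using segseg[OF 4(1,2) \<open>x \<noteq> y\<close>] 4 by (simp only: crv2 pos2 image_insert image_empty)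
      qed
    qed
    ultimately show "drawn_in UNIV ?V (E1 \<union> E2) pos' crv'"
      by (simp add: drawn_in_def)
  qed
  then show ?thesis using that unfolding E1_def E2_def by blast
qed

section \<open>From the drawing in the disk to the layer bound\<close>

theorem theorem7p3:
  fixes V :: "'a set" and E :: "'a set set"
    and pos :: "'a \<Rightarrow> complex" and crv :: "'a set \<Rightarrow> real \<Rightarrow> complex"
    and c :: complex and r :: real and X :: "'a set"
  assumes "simple_graph V E"
    and "r > 0"
    and "drawn_in (cball c r) V E pos crv"
    and "X = {v \<in> V. pos v \<in> sphere c r}"
    and "(\<Sum>v\<in>V - X. max (6 - int (vertex_degree E v)) 0) \<le> 5"
    and "card X \<ge> 3"
  shows "real (card V) \<le> (real (card X))\<^sup>2 / 2 + 3 * real (card X) / 2 - 1"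
proof -
  have "drawn_in UNIV V E pos crv" using assms(3) by (auto simp: drawn_in_def)
  then interpret P: plane_graph V E pos crv using assms(1) by unfold_locales
  have sub: "P.img E \<subseteq> cball c r" "pos ` V \<subseteq> cball c r" "X \<subseteq> V" "pos ` X \<subseteq> sphere c r"
    using assms(3,4) by (auto simp: P.img_def drawn_in_def)
  define E' where "E' = (`) Some ` E \<union> (\<lambda>x. {None, Some x}) ` X"
  obtain pos' crv' where "plane_graph (insert None (Some ` V)) E' pos' crv'"
    using P.add_apex[OF sub(1,2) assms(2) sub(3,4)] unfolding E'_def .
  then interpret G: plane_graph "insert None (Some ` V)" E' pos' crv' .
  have finX: "finite X" "finite V" using P.finite_V sub(3) finite_subset by auto
  \<comment> \<open>Only the vertices of \<open>X\<close> gain an edge to the apex, so the degrees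
    in the hypothesis are preserved.\<close>
  have deg: "vertex_degree E' (Some v) = vertex_degree E v" if "v \<in> V - X" for v
  proof -
    have "{e \<in> E'. Some v \<in> e} = (`) Some ` {e \<in> E. v \<in> e}"
      using that by (auto simp: E'_def)
    moreover have "inj_on ((`) Some) A" for A :: "'a set set" by (simp add: inj_on_def inj_image_eq_iff)
    ultimately show ?thesis by (simp add: vertex_degree_def card_image)
  qed
  \<comment> \<open>The layers start from the apex alone as a one-vertex tree, with \<open>X\<close>
    as the first layer.\<close>
  have "G.tree_on {None} {}" by (simp add: G.tree_on_def leafless_def)
  moreover have "Some ` X = {v \<in> insert None (Some ` V) - {None}. \<exists>s\<in>{None}. {v, s} \<in> E'}"
    using sub(3) by (auto simp: E'_def insert_commute doubleton_eq_iff)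
  moreover have "Some ` X \<noteq> {}" using assms(6) by auto
  moreover have "Some ` (V - X) = insert None (Some ` V) - {None} - Some ` X" by auto
  moreover have "(\<Sum>v\<in>U'. 6 - int (vertex_degree E' v)) \<le> 5" if U': "U' \<subseteq> Some ` (V - X)" for U'
  proof -
    obtain W where W: "W \<subseteq> V - X" "U' = Some ` W" using U' by (meson subset_imageE)
    have "(\<Sum>v\<in>U'. 6 - int (vertex_degree E' v)) = (\<Sum>v\<in>W. 6 - int (vertex_degree E' (Some v)))"
      unfolding W(2) by (subst sum.reindex) auto
    also have "\<dots> = (\<Sum>v\<in>W. 6 - int (vertex_degree E v))"
      using W(1) deg by (intro sum.cong) auto
    \<comment> \<open>The terms may be negative; cutting them off at 0 makes the sum monotone in the
      set, so every subset of \<open>V - X\<close> obeys the bound.\<close>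
    also have "\<dots> \<le> (\<Sum>v\<in>W. max (6 - int (vertex_degree E v)) 0)" by (intro sum_mono) auto
    also have "\<dots> \<le> (\<Sum>v\<in>V - X. max (6 - int (vertex_degree E v)) 0)"
      using W(1) finX by (intro sum_mono2) auto
    finally show ?thesis using assms(5) by simp
  qed
  ultimately have "2 * card (Some ` (V - X)) \<le> card (Some ` X) * (card (Some ` X) - 1) + 2"
    by (rule G.layer_bound)
  then have u: "2 * card (V - X) \<le> card X * (card X - 1) + 2" by (simp add: card_image)
  have "card V = card X + card (V - X)"
    using finX sub(3) by (simp add: card_Diff_subset card_mono)
  moreover have "real (card X * (card X - 1)) = (real (card X))\<^sup>2 - real (card X)"
    using assms(6) by (simp add: of_nat_diff power2_eq_square algebra_simps)
  then have "2 * real (card (V - X)) \<le> (real (card X))\<^sup>2 - real (card X) + 2"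
    using of_nat_mono[OF u, where 'a = real] by simp
  moreover have "real (card X) \<ge> 3" using assms(6) by simp
  \<comment> \<open>With \<open>k = card X\<close> the layers give at most
    \<open>k^2/2 + k/2 + 1\<close> vertices, and \<open>k/2 + 1 \<le> 3*k/2 - 1\<close> as
    \<open>k \<ge> 3\<close>.\<close>
  ultimately show ?thesis by simp
qed

end
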